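(* Let $\beta>1$ and let $G$ be a connected plane 4-regular graph with $n$ vertices, with the black/white face coloring, black-face graph $H^*=(\mathcal{B},E^* )$ and edge weights $\beta_e$ as in the context. Then the worm process $P$ on $H^*$ with edge weights $\beta_e$ (which is the worm process for the planar four-vertex model $Z_{4V}(G;\beta,1)$ under the canonical labeling) has mixing time $$\tau_\varepsilon(P)\le 4n^7\left(\frac{\ln(2\varepsilon^{-1})}{n}+\ln\frac{2(\beta_{\min}+1)}{\beta_{\min}-1}\right),$$ where $\beta_{\min}=\min_{e\in E^*}\beta_e$.
   Context: Planar four-vertex model under canonical labeling. Let $G=(V,E)$ be a connected plane 4-regular graph, $n=|V|$. Its faces admit a proper 2-coloring (adjacent faces get different colors) by black and white with the outer face white; around each vertex the four corners alternate black, white, black, white. The model sums over orientations of $E$ such that at every vertex, for each of its two black corners, of the two edges bounding that corner one points into and one out of the vertex; then the boundary of each black face is a directed closed walk, clockwise or counterclockwise. The weight of such an orientation is $\beta^{N}$, where $N$ is the number of vertices whose two black corners lie in black faces (possibly the same face) with the same rotational direction; $Z_{4V}(G;\beta,1)$ is the sum of these weights. Assigning to each black face $0$ or $1$ according to its direction, this equals $\sum_{\sigma:\mathcal{B}\to\{0,1\}}\prod_{\{u,v\}\in E^*}\beta_{uv}^{\mathbf{I}(\sigma(u)=\sigma(v))}$ up to the constant factor from vertices whose two black corners lie in the same face, where: $\mathcal{B}$ is the set of black faces, $k=|\mathcal{B}|$; for distinct $F_1,F_2\in\mathcal{B}$, $\{F_1,F_2\}\in E^*$ iff some vertex of $G$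 has its two black corners in $F_1$ and $F_2$, and $\beta_{F_1F_2}=\beta^{r}$ with $r$ the number of such vertices. Worm process on $H^*=(\mathcal{B},E^* )$ with $m:=k$ vertices: $x_e=(\beta_e-1)/(\beta_e+1)$; $\Omega_j$ is the set of $S\subseteq E^*$ with exactly $j$ odd-degree vertices in $(\mathcal{B},S)$, $\partial S$ that set; state space $\Omega_0\cup\Omega_2$; $d(u)$ the degree of $u$ in $H^*$. For $\{u,v\}\in E^*$, with $A\oplus uv$ the symmetric difference of $A$ and $\{\{u,v\}\}$: $P(A,A\oplus uv)=x_{uv}^{\mathbf{I}(uv\notin A)}\frac1{2m}\big(\frac1{d(u)}+\frac1{d(v)}\big)$ if $A\in\Omega_0$; $=x_{uv}^{\mathbf{I}(uv\notin A)}\frac14\big(\frac1{d(u)}+\frac1{d(v)}\big)$ if $A\oplus uv\in\Omega_0$; $=\min\!\big(1,\frac{d(u)}{d(v)}x_{uv}^{\mathbf{I}(uv\notin A)-\mathbf{I}(uv\in A)}\big)\frac1{4d(u)}$ if $A,A\oplus uv\in\Omega_2$ and $u\in\partial A$; other off-diagonal entries $0$, diagonal entries $1$ minus the rest of the row. Stationary distribution $\pi(S)\propto\xi(S)\prod_{e\in S}x_e$, $\xi=m$ on $\Omega_0$, $2$ on $\Omega_2$. Mixing time: $\tau_\varepsilon(P)=\min\{t:\max_{x}\|P^t(x,\cdot)-\pi\|_{\mathrm{TV}}\le\varepsilon\}$, $\|\mu-\nu\|_{\mathrm{TV}}=\frac12\sum_x|\mu(x)-\nu(x)|$. *)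

theory Defs
  imports Complex_Main
begin

section \<open>Plane 4-regular graphs as combinatorial maps\<close>

text \<open>A plane (connected) graph is encoded by a combinatorial map on a finite set D of
darts (half-edges): a fixed-point-free involution alpha (the two darts of an edge) and a
permutation sigma (counterclockwise rotation of the darts around their vertex).
Vertices = sigma-orbits, edges = alpha-orbits, faces = orbits of phi = sigma o alpha.
Planarity (genus 0) is Euler's formula V - E + F = 2 for the connected map.\<close>

definition orb :: "('d \<Rightarrow> 'd) \<Rightarrow> 'd \<Rightarrow> 'd set" where
  "orb f d = {(f ^^ n) d | n. True}"

definition map_vertices :: "'d set \<Rightarrow> ('d \<Rightarrow> 'd) \<Rightarrow> 'd set set" where
  "map_vertices D \<sigma> = orb \<sigma> ` D"

definition map_edges :: "'d set \<Rightarrow> ('d \<Rightarrow> 'd) \<Rightarrow> 'd set set" where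
  "map_edges D \<alpha> = orb \<alpha> ` D"

definition face_of :: "('d \<Rightarrow> 'd) \<Rightarrow> ('d \<Rightarrow> 'd) \<Rightarrow> 'd \<Rightarrow> 'd set" where
  "face_of \<alpha> \<sigma> d = orb (\<sigma> \<circ> \<alpha>) d"

definition map_faces :: "'d set \<Rightarrow> ('d \<Rightarrow> 'd) \<Rightarrow> ('d \<Rightarrow> 'd) \<Rightarrow> 'd set set" where
  "map_faces D \<alpha> \<sigma> = face_of \<alpha> \<sigma> ` D"

definition plane_4regular_map :: "'d set \<Rightarrow> ('d \<Rightarrow> 'd) \<Rightarrow> ('d \<Rightarrow> 'd) \<Rightarrow> bool" where
  "plane_4regular_map D \<alpha> \<sigma> \<longleftrightarrow>
     finite D \<and> D \<noteq> {} \<and>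
     (\<forall>d\<in>D. \<alpha> d \<in> D \<and> \<alpha> (\<alpha> d) = d \<and> \<alpha> d \<noteq> d) \<and>
     bij_betw \<sigma> D D \<and>
     (\<forall>d\<in>D. card (orb \<sigma> d) = 4) \<and>
     (\<forall>d\<in>D. \<forall>e\<in>D. (d, e) \<in> ({(x, \<alpha> x) | x. x \<in> D} \<union> {(x, \<sigma> x) | x. x \<in> D})\<^sup>*) \<and>
     card (map_vertices D \<sigma>) + card (map_faces D \<alpha> \<sigma>) = card (map_edges D \<alpha>) + 2"

text \<open>The dart d also names the corner between d and sigma d at its vertex; this corner lies
in the face traversed by phi through sigma d.\<close>

definition corner_face :: "('d \<Rightarrow> 'd) \<Rightarrow> ('d \<Rightarrow> 'd) \<Rightarrow> 'd \<Rightarrow> 'd set" where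
  "corner_face \<alpha> \<sigma> d = face_of \<alpha> \<sigma> (\<sigma> d)"

text \<open>Black/white face colouring: adjacent faces (the two sides d, alpha d of an edge)
get different colours; the outer face (the face of dart o) is white.\<close>

definition bw_coloring ::
  "'d set \<Rightarrow> ('d \<Rightarrow> 'd) \<Rightarrow> ('d \<Rightarrow> 'd) \<Rightarrow> 'd \<Rightarrow> ('d set \<Rightarrow> bool) \<Rightarrow> bool" where
  "bw_coloring D \<alpha> \<sigma> od black \<longleftrightarrow>
     od \<in> D \<and> \<not> black (face_of \<alpha> \<sigma> od) \<and>
     (\<forall>d\<in>D. black (face_of \<alpha> \<sigma> d) \<noteq> black (face_of \<alpha> \<sigma> (\<alpha> d)))"

definition black_faces :: "'d set \<Rightarrow> ('d \<Rightarrow> 'd) \<Rightarrow> ('d \<Rightarrow> 'd) \<Rightarrow> ('d set \<Rightarrow> bool) \<Rightarrow> 'd set set" where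
  "black_faces D \<alpha> \<sigma> black = {F \<in> map_faces D \<alpha> \<sigma>. black F}"

text \<open>The set of black faces containing the black corners of vertex v.\<close>

definition vertex_black :: "('d \<Rightarrow> 'd) \<Rightarrow> ('d \<Rightarrow> 'd) \<Rightarrow> ('d set \<Rightarrow> bool) \<Rightarrow> 'd set \<Rightarrow> 'd set set" where
  "vertex_black \<alpha> \<sigma> black v = {corner_face \<alpha> \<sigma> x | x. x \<in> v \<and> black (corner_face \<alpha> \<sigma> x)}"

text \<open>Edges of the black-face graph H*: pairs of distinct black faces containing the two
black corners of some vertex.\<close>

definition black_edges ::
  "'d set \<Rightarrow> ('d \<Rightarrow> 'd) \<Rightarrow> ('d \<Rightarrow> 'd) \<Rightarrow> ('d set \<Rightarrow> bool) \<Rightarrow> 'd set set set" where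
  "black_edges D \<alpha> \<sigma> black =
     {vertex_black \<alpha> \<sigma> black v | v. v \<in> map_vertices D \<sigma> \<and> card (vertex_black \<alpha> \<sigma> black v) = 2}"

text \<open>r(e): number of vertices whose two black corners lie in the two faces of e.\<close>

definition black_mult ::
  "'d set \<Rightarrow> ('d \<Rightarrow> 'd) \<Rightarrow> ('d \<Rightarrow> 'd) \<Rightarrow> ('d set \<Rightarrow> bool) \<Rightarrow> 'd set set \<Rightarrow> nat" where
  "black_mult D \<alpha> \<sigma> black e = card {v \<in> map_vertices D \<sigma>. vertex_black \<alpha> \<sigma> black v = e}"

section \<open>The worm process on a graph (Vs, Es) with edge weights x\<close>

definition gdeg :: "'v set set \<Rightarrow> 'v \<Rightarrow> nat" where
  "gdeg Es u = card {e \<in> Es. u \<in> e}"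

definition odd_verts :: "'v set \<Rightarrow> 'v set set \<Rightarrow> 'v set" where
  "odd_verts Vs S = {u \<in> Vs. odd (card {e \<in> S. u \<in> e})}"

definition Omega :: "'v set \<Rightarrow> 'v set set \<Rightarrow> nat \<Rightarrow> 'v set set set" where
  "Omega Vs Es j = {S. S \<subseteq> Es \<and> card (odd_verts Vs S) = j}"

definition worm_states :: "'v set \<Rightarrow> 'v set set \<Rightarrow> 'v set set set" where
  "worm_states Vs Es = Omega Vs Es 0 \<union> Omega Vs Es 2"

text \<open>Transition probability from A to A symmetric-difference {e}.\<close>

definition worm_step :: "'v set \<Rightarrow> 'v set set \<Rightarrow> ('v set \<Rightarrow> real) \<Rightarrow> 'v set set \<Rightarrow> 'v set \<Rightarrow> real" where
  "worm_step Vs Es x A e =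
    (let B = A \<union> {e} - (A \<inter> {e});
         xe = (if e \<notin> A then x e else 1);
         m = real (card Vs);
         s = (\<Sum>w\<in>e. 1 / real (gdeg Es w))
     in if A \<in> Omega Vs Es 0 then xe * (1 / (2 * m)) * s
        else if B \<in> Omega Vs Es 0 then xe * (1 / 4) * s
        else if A \<in> Omega Vs Es 2 \<and> B \<in> Omega Vs Es 2 then
          (\<Sum>u\<in>e \<inter> odd_verts Vs A.
             let v = the_elem (e - {u}) in
             min 1 (real (gdeg Es u) / real (gdeg Es v) * (if e \<notin> A then x e else 1 / x e))
               * (1 / (4 * real (gdeg Es u))))
        else 0)"

definition worm_off :: "'v set \<Rightarrow> 'v set set \<Rightarrow> ('v set \<Rightarrow> real) \<Rightarrow> 'v set set \<Rightarrow> 'v set set \<Rightarrow> real" where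
  "worm_off Vs Es x A B =
     (\<Sum>e\<in>Es. if B = A \<union> {e} - (A \<inter> {e}) then worm_step Vs Es x A e else 0)"

definition worm_P :: "'v set \<Rightarrow> 'v set set \<Rightarrow> ('v set \<Rightarrow> real) \<Rightarrow> 'v set set \<Rightarrow> 'v set set \<Rightarrow> real" where
  "worm_P Vs Es x A B =
     (if A = B then 1 - (\<Sum>B'\<in>worm_states Vs Es - {A}. worm_off Vs Es x A B')
      else worm_off Vs Es x A B)"

definition worm_weight :: "'v set \<Rightarrow> 'v set set \<Rightarrow> ('v set \<Rightarrow> real) \<Rightarrow> 'v set set \<Rightarrow> real" where
  "worm_weight Vs Es x S =
     (if S \<in> Omega Vs Es 0 then real (card Vs) else 2) * (\<Prod>e\<in>S. x e)"

definition worm_pi :: "'v set \<Rightarrow> 'v set set \<Rightarrow> ('v set \<Rightarrow> real) \<Rightarrow> 'v set set \<Rightarrow> real" where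
  "worm_pi Vs Es x S =
     worm_weight Vs Es x S / (\<Sum>T\<in>worm_states Vs Es. worm_weight Vs Es x T)"

section \<open>Markov chains on a finite state space: matrix powers, TV distance, mixing time\<close>

fun mat_pow :: "'s set \<Rightarrow> ('s \<Rightarrow> 's \<Rightarrow> real) \<Rightarrow> nat \<Rightarrow> 's \<Rightarrow> 's \<Rightarrow> real" where
  "mat_pow \<Omega> P 0 a b = (if a = b then 1 else 0)"
| "mat_pow \<Omega> P (Suc t) a b = (\<Sum>c\<in>\<Omega>. mat_pow \<Omega> P t a c * P c b)"

definition tv_dist :: "'s set \<Rightarrow> ('s \<Rightarrow> real) \<Rightarrow> ('s \<Rightarrow> real) \<Rightarrow> real" where
  "tv_dist \<Omega> \<mu> \<nu> = (1/2) * (\<Sum>a\<in>\<Omega>. \<bar>\<mu> a - \<nu> a\<bar>)"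

definition mixing_time :: "'s set \<Rightarrow> ('s \<Rightarrow> 's \<Rightarrow> real) \<Rightarrow> ('s \<Rightarrow> real) \<Rightarrow> real \<Rightarrow> nat" where
  "mixing_time \<Omega> P \<pi> \<epsilon> =
     (LEAST t. \<forall>a\<in>\<Omega>. tv_dist \<Omega> (mat_pow \<Omega> P t a) \<pi> \<le> \<epsilon>)"

end

theory Submission
  imports Defs
begin

text \<open>The spectral gap is bounded by canonical paths ending in \<open>\<Omega>\<^sub>0\<close>. The path from \<open>I\<close> to \<open>F\<close> flips
  the edges of \<open>X = I \<oplus> F\<close> in an order depending only on \<open>X\<close>, chosen so that every suffix of it has at
  most two odd vertices; then every intermediate state is a worm state. A state \<open>A\<close> on the path that
  flips \<open>e\<close> is encoded by \<open>X \<oplus> (A \<union> e)\<close>, which satisfies \<open>x(I) x(F) = x(A \<union> e) x(X \<oplus> (A \<union> e))\<close>, and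
  the weights of the encodings are summed with the high temperature inequality
  \<open>Z\<^sub>T \<le> Z\<^sub>0\<close>, where \<open>Z\<^sub>T\<close> is the total weight of the edge sets with odd-vertex set \<open>T\<close>. For a graph with
  \<open>k\<close> vertices and \<open>m\<close> edges this bounds the relaxation time by \<open>4 m\<^sup>2 k\<^sup>2\<close>; Euler's formula gives
  \<open>m \<le> n\<close> and \<open>k \<le> n + 1\<close>, hence the bound \<open>4 n\<^sup>6\<close> for \<open>n \<ge> 2\<close>. The factor \<open>n (ln (2/\<epsilon>)/n + \<dots>)\<close>
  comes from the least stationary probability.\<close>

section \<open>Mixing of lazy reversible chains\<close>

text \<open>Cauchy-Schwarz, read off from the nonnegative double sum of
  \<open>w a * w b * (y a - y b)^2\<close>. It serves with \<open>w = \<pi>\<close> to pass from L1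
  to L2 and with \<open>w = 1\<close> along a path.\<close>

lemma square_weighted_sum_le:
  fixes w y :: "'a \<Rightarrow> real"
  assumes "\<And>a. a \<in> S \<Longrightarrow> 0 \<le> w a"
  shows "(\<Sum>a\<in>S. w a * y a)\<^sup>2 \<le> (\<Sum>a\<in>S. w a) * (\<Sum>a\<in>S. w a * (y a)\<^sup>2)"
proof -
  have "0 \<le> (\<Sum>a\<in>S. \<Sum>b\<in>S. w a * w b * (y a - y b)\<^sup>2)"
    using assms by (intro sum_nonneg) auto
  also have "\<dots> = (\<Sum>a\<in>S. \<Sum>b\<in>S. w a * (w b * (y b)\<^sup>2))
      + (\<Sum>a\<in>S. \<Sum>b\<in>S. (w a * (y a)\<^sup>2) * w b)
      - 2 * (\<Sum>a\<in>S. \<Sum>b\<in>S. (w a * y a) * (w b * y b))"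
    unfolding sum_distrib_left[of 2] sum.distrib[symmetric] sum_subtractf[symmetric]
    by (intro sum.cong refl) (simp add: power2_eq_square algebra_simps)
  also have "\<dots> = 2 * ((\<Sum>a\<in>S. w a) * (\<Sum>a\<in>S. w a * (y a)\<^sup>2)) - 2 * (\<Sum>a\<in>S. w a * y a)\<^sup>2"
    unfolding sum_product[symmetric] power2_eq_square by (simp add: algebra_simps)
  finally show ?thesis by simp
qed

locale lazy_reversible_chain =
  fixes \<Omega> :: "'s set" and P :: "'s \<Rightarrow> 's \<Rightarrow> real" and \<pi> :: "'s \<Rightarrow> real"
  assumes finite_states: "finite \<Omega>"
    and pi_pos: "a \<in> \<Omega> \<Longrightarrow> 0 < \<pi> a"
    and pi_sum: "(\<Sum>a\<in>\<Omega>. \<pi> a) = 1"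
    and P_nonneg: "a \<in> \<Omega> \<Longrightarrow> b \<in> \<Omega> \<Longrightarrow> 0 \<le> P a b"
    and P_row: "a \<in> \<Omega> \<Longrightarrow> (\<Sum>b\<in>\<Omega>. P a b) = 1"
    and reversible: "a \<in> \<Omega> \<Longrightarrow> b \<in> \<Omega> \<Longrightarrow> \<pi> a * P a b = \<pi> b * P b a"
    and lazy: "a \<in> \<Omega> \<Longrightarrow> 1 / 2 \<le> P a a"
begin

section \<open>The L2 space of the stationary distribution\<close>

definition ip :: "('s \<Rightarrow> real) \<Rightarrow> ('s \<Rightarrow> real) \<Rightarrow> real" where
  "ip f g = (\<Sum>a\<in>\<Omega>. \<pi> a * (f a * g a))"

definition op :: "('s \<Rightarrow> real) \<Rightarrow> 's \<Rightarrow> real" where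
  "op f a = (\<Sum>b\<in>\<Omega>. P a b * f b)"

text \<open>\<open>\<rho>\<close> bounds the relaxation time: the variance is at most
  \<open>\<rho>\<close> times the Dirichlet form, and the factor 1/2 belongs to the latter.\<close>

definition poincare :: "real \<Rightarrow> bool" where
  "poincare \<rho> \<longleftrightarrow> (\<forall>f. (\<Sum>a\<in>\<Omega>. \<pi> a * f a) = 0 \<longrightarrow>
     (\<Sum>a\<in>\<Omega>. \<pi> a * (f a)\<^sup>2) \<le> \<rho> / 2 * (\<Sum>a\<in>\<Omega>. \<Sum>b\<in>\<Omega>. \<pi> a * P a b * (f a - f b)\<^sup>2))"

lemma poincare_mono:
  assumes "poincare \<rho>" "\<rho> \<le> \<rho>'"
  shows "poincare \<rho>'"
  unfolding poincare_def
proof (intro allI impI)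
  fix f assume "(\<Sum>a\<in>\<Omega>. \<pi> a * f a) = 0"
  then have "(\<Sum>a\<in>\<Omega>. \<pi> a * (f a)\<^sup>2)
      \<le> \<rho> / 2 * (\<Sum>a\<in>\<Omega>. \<Sum>b\<in>\<Omega>. \<pi> a * P a b * (f a - f b)\<^sup>2)"
    using assms(1) unfolding poincare_def by blast
  also have "\<dots> \<le> \<rho>' / 2 * (\<Sum>a\<in>\<Omega>. \<Sum>b\<in>\<Omega>. \<pi> a * P a b * (f a - f b)\<^sup>2)"
    using assms(2) pi_pos P_nonneg
    by (intro mult_right_mono sum_nonneg mult_nonneg_nonneg) (auto simp: less_imp_le)
  finally show "(\<Sum>a\<in>\<Omega>. \<pi> a * (f a)\<^sup>2)
      \<le> \<rho>' / 2 * (\<Sum>a\<in>\<Omega>. \<Sum>b\<in>\<Omega>. \<pi> a * P a b * (f a - f b)\<^sup>2)" .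
qed

lemma ip_op: "ip f (op g) = (\<Sum>a\<in>\<Omega>. \<Sum>b\<in>\<Omega>. \<pi> a * P a b * (f a * g b))"
  unfolding ip_def op_def sum_distrib_left by (intro sum.cong refl) (simp add: algebra_simps)

lemma ip_op_commute: "ip f (op g) = ip (op f) g"
proof -
  have "ip f (op g) = (\<Sum>b\<in>\<Omega>. \<Sum>a\<in>\<Omega>. \<pi> a * P a b * (f a * g b))"
    unfolding ip_op by (rule sum.swap)
  also have "\<dots> = (\<Sum>b\<in>\<Omega>. \<Sum>a\<in>\<Omega>. \<pi> b * P b a * (g b * f a))"
    by (intro sum.cong refl) (simp add: reversible)
  also have "\<dots> = ip g (op f)" by (simp add: ip_op)
  finally show ?thesis by (simp add: ip_def mult.commute)
qed

lemma sum_flow_square_left: "(\<Sum>a\<in>\<Omega>. \<Sum>b\<in>\<Omega>. \<pi> a * P a b * (f a)\<^sup>2) = ip f f"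
proof -
  have "(\<Sum>b\<in>\<Omega>. \<pi> a * P a b * (f a)\<^sup>2) = \<pi> a * (f a * f a)" if "a \<in> \<Omega>" for a
  proof -
    have "(\<Sum>b\<in>\<Omega>. \<pi> a * P a b * (f a)\<^sup>2) = \<pi> a * (f a)\<^sup>2 * (\<Sum>b\<in>\<Omega>. P a b)"
      unfolding sum_distrib_left by (intro sum.cong refl) simp
    then show ?thesis using that by (simp add: P_row power2_eq_square)
  qed
  then show ?thesis unfolding ip_def by (intro sum.cong refl) simp
qed

lemma sum_flow_square_right: "(\<Sum>a\<in>\<Omega>. \<Sum>b\<in>\<Omega>. \<pi> a * P a b * (f b)\<^sup>2) = ip f f"
proof -
  have "(\<Sum>a\<in>\<Omega>. \<Sum>b\<in>\<Omega>. \<pi> a * P a b * (f b)\<^sup>2) = (\<Sum>b\<in>\<Omega>. \<Sum>a\<in>\<Omega>. \<pi> a * P a b * (f b)\<^sup>2)"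
    by (rule sum.swap)
  also have "\<dots> = (\<Sum>b\<in>\<Omega>. \<Sum>a\<in>\<Omega>. \<pi> b * P b a * (f b)\<^sup>2)"
    by (intro sum.cong refl) (simp add: reversible)
  finally show ?thesis by (simp add: sum_flow_square_left)
qed

text \<open>Taking \<open>s = 1\<close> leads to positivity of the operator; taking
  \<open>s = -1\<close> gives twice the Dirichlet form.\<close>

lemma sum_flow_lin_comb:
  "(\<Sum>a\<in>\<Omega>. \<Sum>b\<in>\<Omega>. \<pi> a * P a b * (f a + s * f b)\<^sup>2) = (1 + s\<^sup>2) * ip f f + 2 * s * ip f (op f)"
proof -
  have "(\<Sum>a\<in>\<Omega>. \<Sum>b\<in>\<Omega>. \<pi> a * P a b * (f a + s * f b)\<^sup>2)
    = (\<Sum>a\<in>\<Omega>. \<Sum>b\<in>\<Omega>. \<pi> a * P a b * (f a)\<^sup>2) + s\<^sup>2 * (\<Sum>a\<in>\<Omega>. \<Sum>b\<in>\<Omega>. \<pi> a * P a b * (f b)\<^sup>2)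
      + 2 * s * ip f (op f)"
    unfolding ip_op sum_distrib_left sum.distrib[symmetric]
    by (intro sum.cong refl) (simp add: power2_eq_square algebra_simps)
  then show ?thesis
    unfolding sum_flow_square_left sum_flow_square_right by (simp add: algebra_simps)
qed

text \<open>Laziness makes the operator positive semidefinite: in the expansion with
  \<open>s = 1\<close> the diagonal terms \<open>a = b\<close> alone contribute at least
  \<open>2 * ip f f\<close>.\<close>

lemma ip_op_nonneg: "0 \<le> ip f (op f)"
proof -
  have "2 * ip f f = (\<Sum>a\<in>\<Omega>. 2 * (\<pi> a * (f a * f a)))"
    unfolding ip_def by (simp add: sum_distrib_left)
  also have "\<dots> \<le> (\<Sum>a\<in>\<Omega>. \<pi> a * P a a * (f a + 1 * f a)\<^sup>2)"
  proof (rule sum_mono)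
    fix a assume a: "a \<in> \<Omega>"
    have "0 \<le> (\<pi> a * (f a)\<^sup>2) * (P a a - 1/2)"
      using lazy[OF a] pi_pos[OF a] by (intro mult_nonneg_nonneg) auto
    then show "2 * (\<pi> a * (f a * f a)) \<le> \<pi> a * P a a * (f a + 1 * f a)\<^sup>2"
      by (simp add: power2_eq_square algebra_simps)
  qed
  also have "\<dots> \<le> (\<Sum>a\<in>\<Omega>. \<Sum>b\<in>\<Omega>. \<pi> a * P a b * (f a + 1 * f b)\<^sup>2)"
  proof (rule sum_mono)
    fix a assume a: "a \<in> \<Omega>"
    show "\<pi> a * P a a * (f a + 1 * f a)\<^sup>2 \<le> (\<Sum>b\<in>\<Omega>. \<pi> a * P a b * (f a + 1 * f b)\<^sup>2)"
      using a finite_states pi_pos P_nonneg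
      by (intro member_le_sum[where f = "\<lambda>b. \<pi> a * P a b * (f a + 1 * f b)\<^sup>2"])
         (auto simp: less_imp_le)
  qed
  also have "\<dots> = 2 * ip f f + 2 * ip f (op f)"
    unfolding sum_flow_lin_comb by simp
  finally show ?thesis by simp
qed

text \<open>Stationarity, obtained from self-adjointness and the fact that \<open>op\<close> fixes
  the constant 1 on the states. Hence mean zero is preserved along the iteration.\<close>

lemma mean_op: "(\<Sum>a\<in>\<Omega>. \<pi> a * op f a) = (\<Sum>a\<in>\<Omega>. \<pi> a * f a)"
proof -
  have "op (\<lambda>_. 1) a = 1" if "a \<in> \<Omega>" for a using P_row[OF that] by (simp add: op_def)
  then have "ip (op (\<lambda>_. 1)) f = ip (\<lambda>_. 1) f" unfolding ip_def by (intro sum.cong refl) simp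
  then have "ip (\<lambda>_. 1) (op f) = ip (\<lambda>_. 1) f" by (simp add: ip_op_commute)
  then show ?thesis by (simp add: ip_def)
qed

lemma poincare_ip:
  assumes "poincare \<rho>" "0 < \<rho>" "(\<Sum>a\<in>\<Omega>. \<pi> a * f a) = 0"
  shows "ip f (op f) \<le> (1 - 1 / \<rho>) * ip f f"
proof -
  have "(\<Sum>a\<in>\<Omega>. \<pi> a * (f a)\<^sup>2) = ip f f" by (simp add: ip_def power2_eq_square)
  then have "ip f f \<le> \<rho> / 2 * (\<Sum>a\<in>\<Omega>. \<Sum>b\<in>\<Omega>. \<pi> a * P a b * (f a + (-1) * f b)\<^sup>2)"
    using assms(1)[unfolded poincare_def, rule_format, OF assms(3)] by simp
  also have "\<dots> = \<rho> * (ip f f - ip f (op f))"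
    unfolding sum_flow_lin_comb by (simp add: algebra_simps)
  finally show ?thesis using assms(2) by (simp add: field_simps)
qed

text \<open>Positivity of the operator, applied to \<open>\<lambda>f - Pf\<close>, upgrades the Poincare bound on the quadratic
  form to a bound on the operator norm without any spectral theory.\<close>

lemma ip_op_contraction:
  assumes "poincare \<rho>" "1 \<le> \<rho>" and mean: "(\<Sum>a\<in>\<Omega>. \<pi> a * f a) = 0"
  shows "ip (op f) (op f) \<le> (1 - 1 / \<rho>)\<^sup>2 * ip f f"
proof -
  define l where "l = 1 - 1 / \<rho>"
  have l: "0 \<le> l" using assms(2) by (simp add: l_def)
  let ?g = "op f"
  have f: "ip f ?g \<le> l * ip f f"
    unfolding l_def using assms by (intro poincare_ip) auto
  have g: "ip ?g (op ?g) \<le> l * ip ?g ?g"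
    unfolding l_def using assms mean_op[of f] by (intro poincare_ip) auto
  have key: "2 * s * ip ?g ?g \<le> s\<^sup>2 * (l * ip f f) + l * ip ?g ?g" for s
  proof -
    let ?h = "\<lambda>a. s * f a - ?g a"
    have op_h: "op ?h = (\<lambda>a. s * ?g a - op ?g a)"
      by (rule ext) (simp add: op_def sum_distrib_left sum_subtractf algebra_simps)
    have "ip ?h (op ?h) = s\<^sup>2 * ip f ?g - s * ip f (op ?g) - s * ip ?g ?g + ip ?g (op ?g)"
      unfolding op_h unfolding ip_def sum_distrib_left sum.distrib[symmetric] sum_subtractf[symmetric]
      by (intro sum.cong refl) (simp add: power2_eq_square algebra_simps)
    then have "0 \<le> s\<^sup>2 * ip f ?g - 2 * s * ip ?g ?g + ip ?g (op ?g)"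
      using ip_op_nonneg[of ?h] by (simp add: ip_op_commute[of f "op f"])
    moreover have "s\<^sup>2 * ip f ?g \<le> s\<^sup>2 * (l * ip f f)" using f by (intro mult_left_mono) auto
    ultimately show ?thesis using g by linarith
  qed
  have "ip ?g ?g \<le> l\<^sup>2 * ip f f"
  \<comment> \<open>The choice \<open>s = l\<close> leaves a common factor \<open>l\<close> to
    cancel; when \<open>l = 0\<close>, the choice \<open>s = 1\<close> already forces
    \<open>ip ?g ?g\<close> to be nonpositive.\<close>
  proof (cases "l = 0")
    case True
    then show ?thesis using key[of 1] by simp
  next
    case False
    then have "0 < l" using l by simp
    moreover have "l * ip ?g ?g \<le> l * (l\<^sup>2 * ip f f)"
      using key[of l] by (simp add: power2_eq_square algebra_simps)
    ultimately show ?thesis by simp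
  qed
  then show ?thesis by (simp add: l_def)
qed

text \<open>The density of the law at time \<open>t\<close> relative to \<open>\<pi>\<close>, minus
  1, is the function \<open>h t\<close>. By reversibility it evolves under \<open>op\<close>, it has
  mean zero, and so its L2 norm contracts in each step; Cauchy-Schwarz returns to total
  variation.\<close>

lemma tv_dist_mat_pow_le:
  assumes "poincare \<rho>" "1 \<le> \<rho>" and a: "a \<in> \<Omega>"
  shows "tv_dist \<Omega> (mat_pow \<Omega> P t a) \<pi> \<le> 1 / 2 * (1 - 1 / \<rho>) ^ t / sqrt (\<pi> a)"
proof -
  define h where "h = (\<lambda>t b. mat_pow \<Omega> P t a b / \<pi> b - 1)"
  have pow: "mat_pow \<Omega> P t a b = \<pi> b * (h t b + 1)" if "b \<in> \<Omega>" for t b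
    using pi_pos[OF that] by (simp add: h_def)
  have h_Suc: "h (Suc t) b = op (h t) b" if b: "b \<in> \<Omega>" for t b
  proof -
    have "mat_pow \<Omega> P (Suc t) a b = (\<Sum>c\<in>\<Omega>. (\<pi> c * P c b) * (h t c + 1))"
      by (auto intro!: sum.cong simp: pow)
    also have "\<dots> = \<pi> b * (\<Sum>c\<in>\<Omega>. P b c * h t c + P b c)"
      unfolding sum_distrib_left
      by (intro sum.cong refl) (simp add: reversible[OF _ b] algebra_simps)
    also have "\<dots> = \<pi> b * (op (h t) b + 1)"
      using P_row[OF b] by (simp add: op_def sum.distrib)
    finally show ?thesis using pi_pos[OF b] by (simp add: h_def)
  qed
  have delta: "(\<Sum>b\<in>\<Omega>. (if a = b then 1 else 0) * F b) = (F a :: real)" for F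
  proof -
    have "(\<Sum>b\<in>\<Omega>. (if a = b then 1 else 0) * F b) = (\<Sum>b\<in>\<Omega>. if a = b then F b else 0)"
      by (intro sum.cong) auto
    then show ?thesis using a finite_states by simp
  qed
  have mean: "(\<Sum>b\<in>\<Omega>. \<pi> b * h t b) = 0" for t
  proof (induction t)
    case 0
    have "(\<Sum>b\<in>\<Omega>. \<pi> b * h 0 b) = (\<Sum>b\<in>\<Omega>. (if a = b then 1 else 0) * 1 - \<pi> b)"
    proof (rule sum.cong[OF refl])
      fix b assume "b \<in> \<Omega>"
      then show "\<pi> b * h 0 b = (if a = b then 1 else 0) * 1 - \<pi> b"
        using pi_pos[of b] by (simp add: h_def algebra_simps)
    qed
    then show ?case unfolding sum_subtractf delta by (simp add: pi_sum)
  next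
    case (Suc t)
    then show ?case using mean_op[of "h t"] by (simp add: h_Suc)
  qed
  \<comment> \<open>The initial squared norm is exactly \<open>1 / \<pi> a - 1\<close>; the
    \<open>- 1\<close> is dropped.\<close>
  have norm: "ip (h t) (h t) \<le> ((1 - 1 / \<rho>) ^ t)\<^sup>2 / \<pi> a" for t
  proof (induction t)
    case 0
    have "ip (h 0) (h 0) = (\<Sum>b\<in>\<Omega>. (if a = b then 1 else 0) * (1 / \<pi> b - 2) + \<pi> b)"
      unfolding ip_def
    proof (rule sum.cong[OF refl])
      fix b assume "b \<in> \<Omega>"
      then show "\<pi> b * (h 0 b * h 0 b) = (if a = b then 1 else 0) * (1 / \<pi> b - 2) + \<pi> b"
        using pi_pos[of b] by (auto simp: h_def field_simps)
    qed
    then show ?case unfolding sum.distrib delta by (simp add: pi_sum)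
  next
    case (Suc t)
    have "ip (h (Suc t)) (h (Suc t)) = ip (op (h t)) (op (h t))"
      unfolding ip_def by (intro sum.cong refl) (simp add: h_Suc)
    also have "\<dots> \<le> (1 - 1 / \<rho>)\<^sup>2 * ip (h t) (h t)"
      using assms mean by (intro ip_op_contraction) auto
    also have "\<dots> \<le> (1 - 1 / \<rho>)\<^sup>2 * (((1 - 1 / \<rho>) ^ t)\<^sup>2 / \<pi> a)"
      using Suc by (intro mult_left_mono) auto
    also have "\<dots> = ((1 - 1 / \<rho>) ^ Suc t)\<^sup>2 / \<pi> a" by (simp add: power_mult_distrib)
    finally show ?case .
  qed
  have "(\<Sum>b\<in>\<Omega>. \<bar>mat_pow \<Omega> P t a b - \<pi> b\<bar>) = (\<Sum>b\<in>\<Omega>. \<pi> b * \<bar>h t b\<bar>)"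
  proof (rule sum.cong[OF refl])
    fix b assume b: "b \<in> \<Omega>"
    have "mat_pow \<Omega> P t a b - \<pi> b = \<pi> b * h t b" using pow[OF b] by (simp add: algebra_simps)
    then show "\<bar>mat_pow \<Omega> P t a b - \<pi> b\<bar> = \<pi> b * \<bar>h t b\<bar>"
      using pi_pos[OF b] by (simp add: abs_mult)
  qed
  also have "\<dots> \<le> sqrt (((1 - 1 / \<rho>) ^ t)\<^sup>2 / \<pi> a)"
  proof (rule real_le_rsqrt)
    have "(\<Sum>b\<in>\<Omega>. \<pi> b * \<bar>h t b\<bar>)\<^sup>2 \<le> (\<Sum>b\<in>\<Omega>. \<pi> b) * (\<Sum>b\<in>\<Omega>. \<pi> b * \<bar>h t b\<bar>\<^sup>2)"
      using pi_pos by (intro square_weighted_sum_le) (auto simp: less_imp_le)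
    also have "\<dots> = ip (h t) (h t)" by (simp add: pi_sum ip_def power2_eq_square)
    also note norm[of t]
    finally show "(\<Sum>b\<in>\<Omega>. \<pi> b * \<bar>h t b\<bar>)\<^sup>2 \<le> ((1 - 1 / \<rho>) ^ t)\<^sup>2 / \<pi> a" .
  qed
  also have "\<dots> = (1 - 1 / \<rho>) ^ t / sqrt (\<pi> a)"
    using assms(2) by (simp add: real_sqrt_divide)
  finally show ?thesis by (simp add: tv_dist_def)
qed

end

section \<open>Boundaries of edge sets\<close>

definition sdiff :: "'a set \<Rightarrow> 'a set \<Rightarrow> 'a set"  (infixl "\<triangle>" 65) where
  "A \<triangle> B = (A - B) \<union> (B - A)"

lemma mem_sdiff [simp]: "a \<in> A \<triangle> B \<longleftrightarrow> (a \<in> A) \<noteq> (a \<in> B)"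
  by (auto simp: sdiff_def)

lemma sdiff_assoc: "(A \<triangle> B) \<triangle> C = A \<triangle> (B \<triangle> C)"
  by (rule set_eqI) auto

lemma sdiff_commute: "A \<triangle> B = B \<triangle> A"
  by (rule set_eqI) auto

lemma sdiff_self [simp]: "A \<triangle> A = {}"
  by (rule set_eqI) auto

lemma sdiff_empty [simp]: "A \<triangle> {} = A" "{} \<triangle> A = A"
  by (auto simp: sdiff_def)

lemma sdiff_cancel [simp]: "A \<triangle> B \<triangle> B = A" "B \<triangle> (B \<triangle> A) = A"
  by (rule set_eqI; auto)+

lemma sdiff_subset: "A \<subseteq> C \<Longrightarrow> B \<subseteq> C \<Longrightarrow> A \<triangle> B \<subseteq> C"
  by (auto simp: sdiff_def)

lemma finite_sdiff [simp]: "finite A \<Longrightarrow> finite B \<Longrightarrow> finite (A \<triangle> B)"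
  by (simp add: sdiff_def)

lemma sdiff_singleton: "A \<triangle> {e} = A \<union> {e} - A \<inter> {e}"
  by (auto simp: sdiff_def)

lemma sdiff_eq_iff: "A \<triangle> B = C \<longleftrightarrow> A = C \<triangle> B"
  by auto

text \<open>Translation by \<open>T\<close> is an involution of the group
  \<open>Pow V\<close>.\<close>

lemma sum_sdiff_shift:
  assumes "T \<subseteq> V"
  shows "(\<Sum>R\<in>Pow V. F (R \<triangle> T)) = (\<Sum>R\<in>Pow V. F R)"
  by (rule sum.reindex_bij_witness[where i = "\<lambda>R. R \<triangle> T" and j = "\<lambda>R. R \<triangle> T"])
     (use assms in \<open>auto simp: sdiff_subset\<close>)

lemma odd_card_sdiff:
  assumes "finite A" "finite B"
  shows "odd (card (A \<triangle> B)) \<longleftrightarrow> odd (card A) \<noteq> odd (card B)"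
proof -
  have "card (A \<triangle> B) = card (A - B) + card (B - A)"
    unfolding sdiff_def using assms by (intro card_Un_disjoint) auto
  moreover have "card A = card (A - B) + card (A \<inter> B)"
    using assms by (subst card_Un_disjoint[symmetric]) (auto intro!: arg_cong[where f = card])
  moreover have "card B = card (B - A) + card (A \<inter> B)"
    using assms by (subst card_Un_disjoint[symmetric]) (auto intro!: arg_cong[where f = card])
  ultimately show ?thesis by presburger
qed

text \<open>The boundary map is linear over the field with two elements, since the parity of the
  degree at each vertex is additive.\<close>

lemma odd_verts_sdiff:
  assumes "finite A" "finite B"
  shows "odd_verts V (A \<triangle> B) = odd_verts V A \<triangle> odd_verts V B"
proof -
  have "{e \<in> A \<triangle> B. u \<in> e} = {e \<in> A. u \<in> e} \<triangle> {e \<in> B. u \<in> e}" for u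
    by (rule set_eqI) auto
  then have "odd (card {e \<in> A \<triangle> B. u \<in> e}) \<longleftrightarrow>
      odd (card {e \<in> A. u \<in> e}) \<noteq> odd (card {e \<in> B. u \<in> e})" for u
    using assms by (simp add: odd_card_sdiff)
  then show ?thesis by (intro set_eqI) (auto simp: odd_verts_def)
qed

lemma odd_verts_empty [simp]: "odd_verts V {} = {}"
  by (simp add: odd_verts_def)

lemma odd_verts_singleton:
  assumes "e \<subseteq> V"
  shows "odd_verts V {e} = e"
proof -
  have "{e' \<in> {e}. u \<in> e'} = (if u \<in> e then {e} else {})" for u by auto
  then show ?thesis using assms by (auto simp: odd_verts_def)
qed

text \<open>An element of \<open>X\<close> lies in exactly one of \<open>A\<close> and
  \<open>A \<triangle> X\<close>, an element outside \<open>X\<close> in both or in neither.\<close>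

lemma prod_mult_prod_sdiff:
  fixes x :: "'a \<Rightarrow> real"
  assumes "finite A" "finite X"
  shows "prod x A * prod x (A \<triangle> X) = prod x X * (prod x (A - X))\<^sup>2"
proof -
  have A: "prod x A = prod x (A \<inter> X) * prod x (A - X)"
    using assms by (subst prod.union_disjoint[symmetric]) (auto intro!: prod.cong)
  have X: "prod x X = prod x (A \<inter> X) * prod x (X - A)"
    using assms by (subst prod.union_disjoint[symmetric]) (auto intro!: prod.cong)
  have "prod x (A \<triangle> X) = prod x (A - X) * prod x (X - A)"
    unfolding sdiff_def using assms by (intro prod.union_disjoint) auto
  then show ?thesis by (simp add: A X power2_eq_square)
qed

text \<open>The weight identity behind the canonical path encoding.\<close>

lemma prod_sdiff_exchange:
  fixes x :: "'a \<Rightarrow> real"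
  assumes "finite A" "finite X" "Y \<subseteq> X"
  shows "prod x A * prod x (A \<triangle> X) = prod x (A \<triangle> Y) * prod x (A \<triangle> Y \<triangle> X)"
proof -
  \<comment> \<open>The product depends on \<open>A\<close> only through \<open>A - X\<close>, which
    a change inside \<open>X\<close> leaves alone.\<close>
  have "A \<triangle> Y - X = A - X" using assms(3) by (auto simp: sdiff_def)
  moreover have "finite (A \<triangle> Y)" using assms finite_subset by (auto intro: finite_sdiff)
  ultimately show ?thesis using assms by (simp add: prod_mult_prod_sdiff)
qed

section \<open>Even subgraphs dominate\<close>

text \<open>For edges inside \<open>V\<close> this is the coefficient of \<open>T\<close> in the
  product over \<open>E\<close> of the factors \<open>\<delta>_0 + x_e \<delta>_e\<close>, taken in
  the group algebra of \<open>Pow V\<close>. It is the \<open>T\<close>-part of the high temperature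
  expansion.\<close>

definition bd_sum :: "'v set \<Rightarrow> 'v set set \<Rightarrow> ('v set \<Rightarrow> real) \<Rightarrow> 'v set \<Rightarrow> real" where
  "bd_sum V E x T = (\<Sum>S | S \<subseteq> E \<and> odd_verts V S = T. prod x S)"

text \<open>Multiplication by one more factor: the sets that contain \<open>e\<close> arise from
  those that do not, with the boundary shifted by \<open>e\<close>.\<close>

lemma bd_sum_insert:
  assumes "finite E" "e \<notin> E" "e \<subseteq> V"
  shows "bd_sum V (insert e E) x T = bd_sum V E x T + x e * bd_sum V E x (T \<triangle> e)"
proof -
  let ?A = "\<lambda>T. {S. S \<subseteq> E \<and> odd_verts V S = T}"
  have fin: "finite (?A T)" for T
    by (rule finite_subset[of _ "Pow E"]) (use assms in auto)
  have ins: "odd_verts V (insert e S) = odd_verts V S \<triangle> e" if "S \<subseteq> E" for S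
  proof -
    have "insert e S = S \<triangle> {e}" using assms that by (auto simp: sdiff_def)
    then show ?thesis
      using assms that finite_subset[of S E] by (simp add: odd_verts_sdiff odd_verts_singleton)
  qed
  have split: "{S. S \<subseteq> insert e E \<and> odd_verts V S = T} = ?A T \<union> insert e ` ?A (T \<triangle> e)"
  proof (intro set_eqI iffI)
    fix S assume S: "S \<in> {S. S \<subseteq> insert e E \<and> odd_verts V S = T}"
    show "S \<in> ?A T \<union> insert e ` ?A (T \<triangle> e)"
    proof (cases "e \<in> S")
      case True
      then have "S = insert e (S - {e})" by auto
      moreover have "odd_verts V (S - {e}) = T \<triangle> e"
        using S ins[of "S - {e}"] True by (simp add: insert_absorb subset_insert_iff flip: sdiff_eq_iff)
      ultimately show ?thesis using S by blast
    qed (use S in auto)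
  next
    fix S assume "S \<in> ?A T \<union> insert e ` ?A (T \<triangle> e)"
    then show "S \<in> {S. S \<subseteq> insert e E \<and> odd_verts V S = T}"
      by (auto simp: ins)
  qed
  have inj: "inj_on (insert e) (?A (T \<triangle> e))"
  proof (rule inj_onI)
    fix S S' assume "S \<in> ?A (T \<triangle> e)" "S' \<in> ?A (T \<triangle> e)" and eq: "insert e S = insert e S'"
    then have "e \<notin> S" "e \<notin> S'" using assms(2) by auto
    then show "S = S'" using eq by (simp add: insert_ident)
  qed
  have "bd_sum V (insert e E) x T = bd_sum V E x T + (\<Sum>S\<in>insert e ` ?A (T \<triangle> e). prod x S)"
    unfolding bd_sum_def split using assms(2) fin by (intro sum.union_disjoint) auto
  also have "(\<Sum>S\<in>insert e ` ?A (T \<triangle> e). prod x S) = x e * bd_sum V E x (T \<triangle> e)"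
    unfolding bd_sum_def sum.reindex[OF inj] sum_distrib_left
  proof (rule sum.cong[OF refl])
    fix S assume "S \<in> ?A (T \<triangle> e)"
    then have "finite S" "e \<notin> S" using assms finite_subset[of S E] by auto
    then show "(prod x \<circ> insert e) S = x e * prod x S" by simp
  qed
  finally show ?thesis .
qed

text \<open>Each factor \<open>\<delta>\<^sub>0 + x\<^sub>e \<delta>\<^sub>e\<close> with \<open>0 \<le> x\<^sub>e \<le> 1\<close> is the convolution square of
  \<open>a \<delta>\<^sub>0 + b \<delta>\<^sub>e\<close>, where \<open>a\<^sup>2 + b\<^sup>2 = 1\<close> and \<open>2ab = x\<^sub>e\<close>.\<close>

lemma bd_sum_convolution_square:
  assumes "finite V" "finite E" "\<And>e. e \<in> E \<Longrightarrow> e \<subseteq> V \<and> 0 \<le> x e \<and> x e \<le> 1"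
  shows "\<exists>G. \<forall>T. T \<subseteq> V \<longrightarrow> bd_sum V E x T = (\<Sum>R\<in>Pow V. G R * G (R \<triangle> T))"
  using assms(2,3)
proof (induction E rule: finite_induct)
  case empty
  let ?G = "\<lambda>R. if R = {} then 1 else 0 :: real"
  have "bd_sum V {} x T = (\<Sum>R\<in>Pow V. ?G R * ?G (R \<triangle> T))" if "T \<subseteq> V" for T
  proof -
    have "bd_sum V {} x T = ?G T"
    proof -
      have "{S. S \<subseteq> {} \<and> odd_verts V S = T} = (if T = {} then {{}} else {})" by auto
      then show ?thesis by (simp add: bd_sum_def)
    qed
    moreover have "(\<Sum>R\<in>Pow V. ?G R * ?G (R \<triangle> T)) = (\<Sum>R\<in>Pow V. if R = {} then ?G T else 0)"
      by (intro sum.cong) auto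
    ultimately show ?thesis using assms(1) by simp
  qed
  then show ?case by (intro exI[of _ ?G] allI impI)
next
  case (insert e E)
  then obtain G where G: "\<And>T. T \<subseteq> V \<Longrightarrow> bd_sum V E x T = (\<Sum>R\<in>Pow V. G R * G (R \<triangle> T))"
    by auto
  have e: "e \<subseteq> V" "0 \<le> x e" "x e \<le> 1" using insert.prems by auto
  \<comment> \<open>Chosen so that \<open>a + b\<close> and \<open>a - b\<close> are the roots of
    \<open>1 + x e\<close> and \<open>1 - x e\<close>; the bound \<open>x e <= 1\<close> is what
    gives the second root the right square.\<close>
  define a where "a = (sqrt (1 + x e) + sqrt (1 - x e)) / 2"
  define b where "b = (sqrt (1 + x e) - sqrt (1 - x e)) / 2"
  have sq: "(sqrt (1 + x e))\<^sup>2 = 1 + x e" "(sqrt (1 - x e))\<^sup>2 = 1 - x e" using e by auto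
  have ab: "a\<^sup>2 + b\<^sup>2 = 1" "2 * (a * b) = x e"
    using sq by (auto simp: a_def b_def power2_eq_square field_simps)
  define H where "H R = a * G R + b * G (R \<triangle> e)" for R
  have "bd_sum V (insert e E) x T = (\<Sum>R\<in>Pow V. H R * H (R \<triangle> T))" if T: "T \<subseteq> V" for T
  proof -
    \<comment> \<open>Expanding \<open>H R * H (R \<triangle> T)\<close> gives four correlations.
      Shifting the summation variable by \<open>e\<close> identifies the two pure ones with the
      value at \<open>T\<close> and the two mixed ones with the value at
      \<open>T \<triangle> e\<close>.\<close>
    have 1: "(\<Sum>R\<in>Pow V. G (R \<triangle> e) * G (R \<triangle> T \<triangle> e)) = bd_sum V E x T"
    proof -
      have "(\<Sum>R\<in>Pow V. G (R \<triangle> e) * G (R \<triangle> T \<triangle> e)) = (\<Sum>R\<in>Pow V. G (R \<triangle> e) * G (R \<triangle> e \<triangle> T))"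
        by (simp add: sdiff_assoc sdiff_commute[of T e])
      then show ?thesis using sum_sdiff_shift[OF e(1), of "\<lambda>R. G R * G (R \<triangle> T)"] G[OF T] by simp
    qed
    have 2: "(\<Sum>R\<in>Pow V. G R * G (R \<triangle> T \<triangle> e)) = bd_sum V E x (T \<triangle> e)"
      using G[of "T \<triangle> e"] T e(1) by (simp add: sdiff_subset sdiff_assoc)
    have 3: "(\<Sum>R\<in>Pow V. G (R \<triangle> e) * G (R \<triangle> T)) = bd_sum V E x (T \<triangle> e)"
    proof -
      have "(\<Sum>R\<in>Pow V. G (R \<triangle> e) * G (R \<triangle> T)) = (\<Sum>R\<in>Pow V. G (R \<triangle> e) * G (R \<triangle> e \<triangle> T \<triangle> e))"
        by (intro sum.cong refl arg_cong2[where f = "(*)"] arg_cong[where f = G]) auto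
      then show ?thesis
        using sum_sdiff_shift[OF e(1), of "\<lambda>R. G R * G (R \<triangle> T \<triangle> e)"] 2 by simp
    qed
    have "(\<Sum>R\<in>Pow V. H R * H (R \<triangle> T)) =
        a\<^sup>2 * (\<Sum>R\<in>Pow V. G R * G (R \<triangle> T)) + b\<^sup>2 * (\<Sum>R\<in>Pow V. G (R \<triangle> e) * G (R \<triangle> T \<triangle> e))
        + a * b * (\<Sum>R\<in>Pow V. G R * G (R \<triangle> T \<triangle> e)) + a * b * (\<Sum>R\<in>Pow V. G (R \<triangle> e) * G (R \<triangle> T))"
      unfolding sum_distrib_left sum.distrib[symmetric] H_def
      by (intro sum.cong refl) (simp add: power2_eq_square algebra_simps)
    also have "\<dots> = (a\<^sup>2 + b\<^sup>2) * bd_sum V E x T + 2 * (a * b) * bd_sum V E x (T \<triangle> e)"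
      unfolding 1 2 3 G[OF T, symmetric] by (simp add: algebra_simps)
    finally show ?thesis
      using bd_sum_insert[OF insert.hyps e(1)] by (simp add: ab)
  qed
  then show ?case by (intro exI[of _ H] allI impI)
qed

text \<open>An autocorrelation is largest at the identity of the group: apply
  \<open>2pq <= p^2 + q^2\<close> termwise and shift the second square back.\<close>

lemma bd_sum_le_bd_sum_empty:
  assumes "finite V" "finite E" "\<And>e. e \<in> E \<Longrightarrow> e \<subseteq> V \<and> 0 \<le> x e \<and> x e \<le> 1" and T: "T \<subseteq> V"
  shows "bd_sum V E x T \<le> bd_sum V E x {}"
proof -
  obtain G where G: "\<And>T. T \<subseteq> V \<Longrightarrow> bd_sum V E x T = (\<Sum>R\<in>Pow V. G R * G (R \<triangle> T))"
    using bd_sum_convolution_square[OF assms(1-3)] by auto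
  have "2 * bd_sum V E x T = (\<Sum>R\<in>Pow V. 2 * (G R * G (R \<triangle> T)))"
    by (simp add: G[OF T] sum_distrib_left)
  also have "\<dots> \<le> (\<Sum>R\<in>Pow V. G R * G R + G (R \<triangle> T) * G (R \<triangle> T))"
  proof (rule sum_mono)
    fix R
    show "2 * (G R * G (R \<triangle> T)) \<le> G R * G R + G (R \<triangle> T) * G (R \<triangle> T)"
      using sum_squares_bound[of "G R" "G (R \<triangle> T)"] by (simp add: power2_eq_square)
  qed
  also have "\<dots> = 2 * bd_sum V E x {}"
    using sum_sdiff_shift[OF T, of "\<lambda>R. G R * G R"] G[of "{}"] by (simp add: sum.distrib)
  finally show ?thesis by simp
qed

section \<open>The worm chain\<close>

text \<open>In a move between two states with two odd vertices, one end of the worm travels along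
  \<open>e\<close> from \<open>u\<close> to \<open>v\<close>. If both or neither end of
  \<open>e\<close> were in \<open>A\<close>, the result would have 0 or 4 elements.\<close>

lemma card_sdiff_pair:
  assumes "card A = 2" "card e = 2" "card (A \<triangle> e) = 2"
  obtains u v where "e = {u, v}" "u \<noteq> v" "u \<in> A" "v \<notin> A"
proof -
  obtain p q where e: "e = {p, q}" "p \<noteq> q" using assms(2) by (auto simp: card_2_iff)
  have fin: "finite A" "finite e" using assms by (auto intro: card_ge_0_finite)
  consider "p \<in> A" "q \<in> A" | "p \<notin> A" "q \<notin> A" | "p \<in> A" "q \<notin> A" | "q \<in> A" "p \<notin> A" by blast
  then show ?thesis
  proof cases
    case 1
    then have "A = e" using e fin assms by (metis card_subset_eq empty_subsetI insert_subset)
    then show ?thesis using assms by simp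
  next
    case 2
    then have "A \<inter> e = {}" using e by auto
    then have "A \<triangle> e = A \<union> e" by (auto simp: sdiff_def)
    then have "card (A \<triangle> e) = card A + card e"
      using fin \<open>A \<inter> e = {}\<close> by (simp add: card_Un_disjoint)
    then show ?thesis using assms by simp
  qed (use e in \<open>auto intro: that[of p q] that[of q p]\<close>)
qed

text \<open>The bound \<open>x e <= 1\<close> lets \<open>x e\<close> act as an acceptance
  probability. A nonempty \<open>E\<close> provides two vertices, so the prefactor in every weight
  is at least 2.\<close>

locale worm_graph =
  fixes V :: "'v set" and E :: "'v set set" and x :: "'v set \<Rightarrow> real"
  assumes finite_V: "finite V"
    and edge_subset: "e \<in> E \<Longrightarrow> e \<subseteq> V"
    and edge_card: "e \<in> E \<Longrightarrow> card e = 2"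
    and x_pos: "e \<in> E \<Longrightarrow> 0 < x e"
    and x_le_1: "e \<in> E \<Longrightarrow> x e \<le> 1"
    and edges_nonempty: "E \<noteq> {}"
begin

abbreviation "bd \<equiv> odd_verts V"
abbreviation "states \<equiv> worm_states V E"
abbreviation "even_states \<equiv> Omega V E 0"
abbreviation "weight \<equiv> worm_weight V E x"
abbreviation "step \<equiv> worm_step V E x"
abbreviation "deg u \<equiv> real (gdeg E u)"

lemma finite_E: "finite E"
  by (rule finite_subset[of _ "Pow V"]) (use edge_subset finite_V in auto)

lemma finite_sub: "A \<subseteq> E \<Longrightarrow> finite A"
  using finite_E finite_subset by blast

lemma finite_edge: "e \<in> E \<Longrightarrow> finite e"
  using edge_subset finite_V finite_subset by blast

lemma card_V_ge_2: "2 \<le> card V"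
  using edges_nonempty edge_subset edge_card finite_V by (metis card_mono equals0I)

lemma card_E_pos: "0 < card E"
  using finite_E edges_nonempty by (simp add: card_gt_0_iff)

lemma bd_subset: "bd A \<subseteq> V"
  by (auto simp: odd_verts_def)

lemma finite_bd: "finite (bd A)"
  using bd_subset finite_V finite_subset by blast

lemma bd_sdiff: "A \<subseteq> E \<Longrightarrow> B \<subseteq> E \<Longrightarrow> bd (A \<triangle> B) = bd A \<triangle> bd B"
  by (simp add: odd_verts_sdiff finite_sub)

lemma bd_edge: "A \<subseteq> E \<Longrightarrow> e \<in> E \<Longrightarrow> bd (A \<triangle> {e}) = bd A \<triangle> e"
  by (simp add: bd_sdiff odd_verts_singleton edge_subset)

lemma even_states_iff: "A \<in> even_states \<longleftrightarrow> A \<subseteq> E \<and> bd A = {}"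
  using finite_bd[of A] by (auto simp: Omega_def)

lemma states_iff: "A \<in> states \<longleftrightarrow> A \<subseteq> E \<and> (bd A = {} \<or> card (bd A) = 2)"
  using finite_bd[of A] by (auto simp: worm_states_def Omega_def)

lemma two_states_iff: "A \<in> Omega V E 2 \<longleftrightarrow> A \<in> states \<and> A \<notin> even_states"
  using finite_bd[of A] by (auto simp: worm_states_def Omega_def)

lemma states_subset: "states \<subseteq> Pow E"
  by (auto simp: states_iff)

lemma finite_states: "finite states"
  by (rule finite_subset[OF states_subset]) (simp add: finite_E)

lemma prod_x_pos: "A \<subseteq> E \<Longrightarrow> 0 < prod x A"
  using x_pos by (intro prod_pos) auto

lemma prod_x_antimono: "A \<subseteq> B \<Longrightarrow> B \<subseteq> E \<Longrightarrow> prod x B \<le> prod x A"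
proof -
  assume AB: "A \<subseteq> B" "B \<subseteq> E"
  have "prod x B = prod x (B - A) * prod x A"
    using AB finite_sub by (intro prod.subset_diff) auto
  also have "\<dots> \<le> 1 * prod x A"
    using AB x_pos x_le_1 prod_x_pos[of A]
    by (intro mult_right_mono prod_le_1) (auto simp: less_imp_le subset_iff)
  finally show ?thesis by simp
qed

lemma weight_pos: "A \<subseteq> E \<Longrightarrow> 0 < weight A"
  using card_V_ge_2 prod_x_pos[of A] by (auto simp: worm_weight_def)

lemma total_weight_pos: "0 < (\<Sum>A\<in>states. weight A)"
proof (rule sum_pos)
  have "{} \<in> states" by (simp add: states_iff)
  then show "states \<noteq> {}" by auto
qed (use finite_states weight_pos states_iff in auto)

lemma deg_ge_1: "e \<in> E \<Longrightarrow> u \<in> e \<Longrightarrow> 1 \<le> deg u"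
proof -
  assume "e \<in> E" "u \<in> e"
  then have "card {e \<in> E. u \<in> e} \<noteq> 0" using finite_E by auto
  then show ?thesis by (simp add: gdeg_def)
qed

lemma deg_le: "deg u \<le> card E"
  using finite_E by (simp add: gdeg_def card_mono)

lemma sdiff_edge_subset: "A \<subseteq> E \<Longrightarrow> e \<in> E \<Longrightarrow> A \<triangle> {e} \<subseteq> E"
  by (simp add: sdiff_subset)

lemma insert_sdiff: "insert e (A \<triangle> {e}) = insert e A"
  by auto

lemma prod_insert_edge:
  assumes "A \<subseteq> E"
  shows "prod x A * (if e \<notin> A then x e else 1) = prod x (insert e A)"
  using finite_sub[OF assms] by (auto simp: insert_absorb)

lemma prod_sdiff_edge:
  assumes "A \<subseteq> E" "e \<in> E"
  shows "prod x A * (if e \<notin> A then x e else 1 / x e) = prod x (A \<triangle> {e})"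
proof (cases "e \<in> A")
  case True
  then have "A \<triangle> {e} = A - {e}" by (auto simp: sdiff_def)
  then show ?thesis
    using True finite_sub[OF assms(1)] x_pos[OF assms(2)] by (simp add: prod.remove[of A e])
next
  case False
  then have "A \<triangle> {e} = insert e A" by (auto simp: sdiff_def)
  then show ?thesis using False finite_sub[OF assms(1)] by simp
qed

section \<open>Stationary flow along a single move\<close>

lemma step_sdiff: "step A e =
    (if A \<in> even_states then (if e \<notin> A then x e else 1) * (1 / (2 * card V)) * (\<Sum>w\<in>e. 1 / deg w)
     else if A \<triangle> {e} \<in> even_states then (if e \<notin> A then x e else 1) * (1 / 4) * (\<Sum>w\<in>e. 1 / deg w)
     else if A \<in> states \<and> A \<triangle> {e} \<in> states then
       (\<Sum>u\<in>e \<inter> bd A. min 1 (deg u / deg (the_elem (e - {u})) * (if e \<notin> A then x e else 1 / x e))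
          * (1 / (4 * deg u)))
     else 0)"
  unfolding worm_step_def Let_def sdiff_singleton[symmetric] by (simp add: two_states_iff)

text \<open>The prefactors are made for this: \<open>m * 1/(2m)\<close> and \<open>2 * 1/4\<close>
  are both 1/2. The result is symmetric because \<open>insert e A\<close> is the same for both ends
  of the move.\<close>

lemma weight_step_even:
  assumes "A \<in> states" "A \<triangle> {e} \<in> states" "e \<in> E" "A \<in> even_states \<or> A \<triangle> {e} \<in> even_states"
  shows "weight A * step A e = 1 / 2 * prod x (insert e A) * (\<Sum>w\<in>e. 1 / deg w)"
proof -
  have A: "A \<subseteq> E" using assms by (simp add: states_iff)
  show ?thesis
  proof (cases "A \<in> even_states")
    case True
    then show ?thesis
      using card_V_ge_2 unfolding prod_insert_edge[OF A, symmetric]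
      by (auto simp: worm_weight_def step_sdiff)
  next
    case False
    then show ?thesis
      using assms(4) unfolding prod_insert_edge[OF A, symmetric]
      by (auto simp: worm_weight_def step_sdiff)
  qed
qed

text \<open>The Metropolis rule turns the flow into a minimum of two quantities, which are exchanged
  when \<open>A\<close>, \<open>u\<close> trade places with \<open>A \<triangle> {e}\<close>,
  \<open>v\<close>. Detailed balance follows.\<close>

lemma weight_step_two:
  assumes "A \<in> states" "A \<triangle> {e} \<in> states" "e \<in> E" "A \<notin> even_states" "A \<triangle> {e} \<notin> even_states"
    and e: "e = {u, v}" "u \<noteq> v" "u \<in> bd A" "v \<notin> bd A"
  shows "weight A * step A e = 1 / 2 * min (prod x A / deg u) (prod x (A \<triangle> {e}) / deg v)"
proof -
  have A: "A \<subseteq> E" using assms by (simp add: states_iff)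
  have sets: "e \<inter> bd A = {u}" "e - {u} = {v}" using e by auto
  have du: "0 < deg u" "0 < deg v" using deg_ge_1[OF assms(3)] e by force+
  let ?r = "if e \<notin> A then x e else 1 / x e"
  have "weight A * step A e = 2 * prod x A * (min 1 (deg u / deg v * ?r) * (1 / (4 * deg u)))"
    using assms(1,2,4,5) by (simp add: worm_weight_def step_sdiff sets)
  also have "\<dots> = 1 / 2 * (prod x A / deg u * min 1 (deg u / deg v * ?r))" by simp
  also have "prod x A / deg u * min 1 (deg u / deg v * ?r)
      = min (prod x A / deg u * 1) (prod x A / deg u * (deg u / deg v * ?r))"
    using prod_x_pos[OF A] du by (simp only: min_mult_distrib_left) auto
  also have "prod x A / deg u * (deg u / deg v * ?r) = prod x A * ?r / deg v"
    using du by simp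
  also have "\<dots> = prod x (A \<triangle> {e}) / deg v"
    unfolding prod_sdiff_edge[OF A assms(3)] ..
  finally show ?thesis by simp
qed

lemma two_states_edge:
  assumes "A \<in> states" "A \<triangle> {e} \<in> states" "e \<in> E" "A \<notin> even_states" "A \<triangle> {e} \<notin> even_states"
  obtains u v where "e = {u, v}" "u \<noteq> v" "u \<in> bd A" "v \<notin> bd A"
proof (rule card_sdiff_pair)
  show "card (bd A) = 2" using assms by (auto simp: states_iff even_states_iff)
  show "card e = 2" using assms edge_card by simp
  show "card (bd A \<triangle> e) = 2"
    using assms bd_edge[of A e] by (auto simp: states_iff even_states_iff)
qed (rule that)

lemma weight_step_sym:
  assumes A: "A \<in> states" and B: "A \<triangle> {e} \<in> states" and e: "e \<in> E"
  shows "weight A * step A e = weight (A \<triangle> {e}) * step (A \<triangle> {e}) e"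
proof (cases "A \<in> even_states \<or> A \<triangle> {e} \<in> even_states")
  case True
  then show ?thesis
    using weight_step_even[OF A B e] weight_step_even[OF B _ e] A by (auto simp: insert_sdiff)
next
  case False
  then obtain u v where uv: "e = {u, v}" "u \<noteq> v" "u \<in> bd A" "v \<notin> bd A"
    using two_states_edge[OF A B e] by blast
  have "bd (A \<triangle> {e}) = bd A \<triangle> e" using A e by (simp add: bd_edge states_iff)
  then have vu: "e = {v, u}" "v \<noteq> u" "v \<in> bd (A \<triangle> {e})" "u \<notin> bd (A \<triangle> {e})"
    using uv by auto
  show ?thesis
    using weight_step_two[OF A B e _ _ uv] weight_step_two[OF B _ e _ _ vu] A False
    by (simp add: min.commute)
qed

text \<open>The bound is stated with \<open>insert e A\<close> because that set enters the path
  encoding. Since \<open>x <= 1\<close>, its product is at most those of both ends of the move, and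
  degrees are at most \<open>card E\<close>.\<close>

lemma weight_step_ge:
  assumes A: "A \<in> states" and B: "A \<triangle> {e} \<in> states" and e: "e \<in> E"
  shows "prod x (insert e A) / (2 * card E) \<le> weight A * step A e"
proof -
  have sub: "insert e A \<subseteq> E" using A e by (auto simp: states_iff)
  have pos: "0 < prod x (insert e A)" by (rule prod_x_pos[OF sub])
  have inv: "1 / card E \<le> 1 / deg w" if "w \<in> e" for w
    using deg_le[of w] deg_ge_1[OF e that] by (intro divide_left_mono) auto
  show ?thesis
  proof (cases "A \<in> even_states \<or> A \<triangle> {e} \<in> even_states")
    case True
    obtain w where w: "w \<in> e" using edge_card[OF e] by fastforce
    have "1 / card E \<le> 1 / deg w" by (rule inv[OF w])
    also have "\<dots> \<le> (\<Sum>w\<in>e. 1 / deg w)"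
      using w finite_edge[OF e] by (intro member_le_sum[where f = "\<lambda>w. 1 / deg w"]) auto
    finally have "1 / 2 * prod x (insert e A) * (1 / card E)
        \<le> 1 / 2 * prod x (insert e A) * (\<Sum>w\<in>e. 1 / deg w)"
      using pos by (intro mult_left_mono) auto
    then show ?thesis using weight_step_even[OF A B e True] by simp
  next
    case False
    then obtain u v where uv: "e = {u, v}" "u \<noteq> v" "u \<in> bd A" "v \<notin> bd A"
      using two_states_edge[OF A B e] by blast
    have "prod x (insert e A) * (1 / card E) \<le> prod x A * (1 / deg u)"
      using inv[of u] uv prod_x_antimono[of A, OF _ sub] prod_x_pos[of A] sub
      by (intro mult_mono) auto
    moreover have "prod x (insert e A) * (1 / card E) \<le> prod x (A \<triangle> {e}) * (1 / deg v)"
      using inv[of v] uv prod_x_pos[of "A \<triangle> {e}"] sdiff_edge_subset[of A e] sub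
      by (intro mult_mono prod_x_antimono[OF _ sub]) (auto simp: sdiff_def)
    ultimately show ?thesis using weight_step_two[OF A B e _ _ uv] False by simp
  qed
qed

section \<open>The probability of leaving a state\<close>

lemma step_nonneg: "e \<in> E \<Longrightarrow> 0 \<le> step A e"
proof -
  assume e: "e \<in> E"
  have "0 \<le> x e" using x_pos[OF e] by simp
  moreover have "0 \<le> (\<Sum>w\<in>e. 1 / deg w)" by (intro sum_nonneg) auto
  ultimately show ?thesis
    unfolding step_sdiff by (auto intro!: sum_nonneg mult_nonneg_nonneg divide_nonneg_nonneg)
qed

text \<open>Each \<open>u\<close> in \<open>U\<close> spreads a unit mass evenly over its edges; an
  isolated vertex contributes 0, hence the inequality.\<close>

lemma sum_step_incident_le:
  assumes "U \<subseteq> V"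
  shows "(\<Sum>e\<in>E. \<Sum>u\<in>e \<inter> U. 1 / deg u) \<le> card U"
proof -
  have fin: "finite U" using assms finite_V finite_subset by blast
  have "(\<Sum>e\<in>E. \<Sum>u\<in>e \<inter> U. 1 / deg u) = (\<Sum>e\<in>E. \<Sum>u\<in>U. if u \<in> e then 1 / deg u else 0)"
    using fin by (intro sum.cong[OF refl]) (simp add: sum.inter_restrict[symmetric] Int_commute)
  also have "\<dots> = (\<Sum>u\<in>U. \<Sum>e\<in>E. if u \<in> e then 1 / deg u else 0)"
    by (rule sum.swap)
  also have "\<dots> = (\<Sum>u\<in>U. deg u * (1 / deg u))"
    using finite_E by (intro sum.cong refl) (simp add: sum.inter_filter[symmetric] gdeg_def)
  also have "\<dots> \<le> (\<Sum>u\<in>U. 1)" by (rule sum_mono) auto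
  finally show ?thesis by simp
qed

text \<open>The mass leaving \<open>A\<close> is charged to vertices: \<open>1/(2m)\<close> for each
  of the \<open>m\<close> vertices if \<open>A\<close> is even, and \<open>1/4\<close> for each of
  the two odd vertices otherwise.\<close>

lemma sum_step_le_half:
  assumes A: "A \<in> states"
  shows "(\<Sum>e\<in>E. step A e) \<le> 1 / 2"
proof (cases "A \<in> even_states")
  case True
  have "(\<Sum>e\<in>E. step A e) \<le> (\<Sum>e\<in>E. 1 / (2 * card V) * (\<Sum>u\<in>e \<inter> V. 1 / deg u))"
  proof (rule sum_mono)
    fix e assume e: "e \<in> E"
    have "step A e = (if e \<notin> A then x e else 1) * (1 / (2 * card V) * (\<Sum>w\<in>e. 1 / deg w))"
      using True by (simp add: step_sdiff)
    also have "\<dots> \<le> 1 * (1 / (2 * card V) * (\<Sum>w\<in>e. 1 / deg w))"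
      using x_le_1[OF e] by (intro mult_right_mono mult_nonneg_nonneg sum_nonneg) auto
    finally have "step A e \<le> 1 / (2 * card V) * (\<Sum>w\<in>e. 1 / deg w)" by simp
    moreover have "e \<inter> V = e" using edge_subset[OF e] by auto
    ultimately show "step A e \<le> 1 / (2 * card V) * (\<Sum>u\<in>e \<inter> V. 1 / deg u)" by simp
  qed
  also have "\<dots> = 1 / (2 * card V) * (\<Sum>e\<in>E. \<Sum>u\<in>e \<inter> V. 1 / deg u)"
    by (simp add: sum_distrib_left)
  also have "\<dots> \<le> 1 / (2 * card V) * card V"
    by (intro mult_left_mono sum_step_incident_le) auto
  also have "\<dots> = 1 / 2" using card_V_ge_2 by simp
  finally show ?thesis .
next
  case False
  then have bd2: "card (bd A) = 2" using A by (auto simp: states_iff even_states_iff)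
  have AE: "A \<subseteq> E" using A by (simp add: states_iff)
  have "(\<Sum>e\<in>E. step A e) \<le> (\<Sum>e\<in>E. 1 / 4 * (\<Sum>u\<in>e \<inter> bd A. 1 / deg u))"
  proof (rule sum_mono)
    fix e assume e: "e \<in> E"
    have s0: "0 \<le> 1 / 4 * (\<Sum>u\<in>e \<inter> bd A. 1 / deg u)" by (auto intro: sum_nonneg)
    show "step A e \<le> 1 / 4 * (\<Sum>u\<in>e \<inter> bd A. 1 / deg u)"
    proof (cases "A \<triangle> {e} \<in> even_states")
      case True
      then have "bd A \<triangle> e = {}" using bd_edge[OF AE e] by (simp add: even_states_iff)
      \<comment> \<open>This move closes the worm, so both endpoints of \<open>e\<close> are odd and
        the sum over all of \<open>e\<close> is a sum over odd vertices.\<close>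
      then have "e \<inter> bd A = e" by (auto simp: sdiff_def)
      then have "step A e = (if e \<notin> A then x e else 1) * (1 / 4 * (\<Sum>u\<in>e \<inter> bd A. 1 / deg u))"
        using True False by (simp add: step_sdiff)
      also have "\<dots> \<le> 1 * (1 / 4 * (\<Sum>u\<in>e \<inter> bd A. 1 / deg u))"
        using x_le_1[OF e] s0 by (intro mult_right_mono) auto
      finally show ?thesis by simp
    next
      case odd: False
      show ?thesis
      proof (cases "A \<triangle> {e} \<in> states")
        case True
        let ?m = "\<lambda>u. min 1 (deg u / deg (the_elem (e - {u})) * (if e \<notin> A then x e else 1 / x e))"
        have "step A e = (\<Sum>u\<in>e \<inter> bd A. ?m u * (1 / (4 * deg u)))"
          using True odd False A by (simp add: step_sdiff)
        also have "\<dots> \<le> (\<Sum>u\<in>e \<inter> bd A. 1 * (1 / (4 * deg u)))"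
          by (intro sum_mono mult_right_mono) auto
        finally show ?thesis by (simp add: sum_distrib_left)
      next
        case nst: False
        then show ?thesis using odd False s0 by (simp add: step_sdiff)
      qed
    qed
  qed
  also have "\<dots> = 1 / 4 * (\<Sum>e\<in>E. \<Sum>u\<in>e \<inter> bd A. 1 / deg u)"
    by (simp add: sum_distrib_left)
  also have "\<dots> \<le> 1 / 4 * card (bd A)"
    using bd_subset by (intro mult_left_mono sum_step_incident_le) auto
  finally show ?thesis by (simp add: bd2)
qed

section \<open>From single moves to the transition matrix\<close>

lemma worm_off_eq: "worm_off V E x A B = (\<Sum>e\<in>E. if B = A \<triangle> {e} then step A e else 0)"
  unfolding worm_off_def sdiff_singleton ..

text \<open>Different edges lead to different targets, so only one term of the defining sum
  survives.\<close>

lemma worm_off_sdiff: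
  assumes "e \<in> E"
  shows "worm_off V E x A (A \<triangle> {e}) = step A e"
proof -
  have "A \<triangle> {e} = A \<triangle> {e'} \<longleftrightarrow> e = e'" for e'
    by (metis sdiff_cancel(1) sdiff_commute singleton_inject)
  then show ?thesis using finite_E assms by (simp add: worm_off_eq)
qed

lemma worm_off_nonneg: "0 \<le> worm_off V E x A B"
  unfolding worm_off_eq by (intro sum_nonneg) (auto simp: step_nonneg)

lemma worm_off_cases:
  obtains e where "e \<in> E" "B = A \<triangle> {e}" | "\<And>e. e \<in> E \<Longrightarrow> B \<noteq> A \<triangle> {e}" by blast

lemma sum_worm_off:
  assumes "finite S"
  shows "(\<Sum>B\<in>S. worm_off V E x A B * g B)
    = (\<Sum>e\<in>E. if A \<triangle> {e} \<in> S then step A e * g (A \<triangle> {e}) else 0)"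
proof -
  have "(\<Sum>B\<in>S. worm_off V E x A B * g B)
      = (\<Sum>B\<in>S. \<Sum>e\<in>E. if B = A \<triangle> {e} then step A e * g (A \<triangle> {e}) else 0)"
    unfolding worm_off_eq sum_distrib_right by (intro sum.cong refl) auto
  also have "\<dots> = (\<Sum>e\<in>E. \<Sum>B\<in>S. if B = A \<triangle> {e} then step A e * g (A \<triangle> {e}) else 0)"
    by (rule sum.swap)
  finally show ?thesis using assms by simp
qed

lemma weight_worm_off_sym:
  assumes "A \<in> states" "B \<in> states"
  shows "weight A * worm_off V E x A B = weight B * worm_off V E x B A"
proof (cases B A rule: worm_off_cases)
  case (1 e)
  then have "A = B \<triangle> {e}" by simp
  then show ?thesis
    using weight_step_sym[of A e] worm_off_sdiff[of e A] worm_off_sdiff[of e B] 1 assms by simp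
next
  case 2
  have "A \<noteq> B \<triangle> {e}" if "e \<in> E" for e using 2[OF that] by auto
  then show ?thesis using 2 by (simp add: worm_off_eq)
qed

lemma worm_chain: "lazy_reversible_chain states (worm_P V E x) (worm_pi V E x)"
proof
  let ?W = "\<Sum>T\<in>states. weight T"
  note W = total_weight_pos
  show "finite states" by (rule finite_states)
  show "0 < worm_pi V E x A" if "A \<in> states" for A
    using W weight_pos[of A] that by (simp add: worm_pi_def states_iff)
  show "(\<Sum>A\<in>states. worm_pi V E x A) = 1"
    unfolding worm_pi_def sum_divide_distrib[symmetric] using W by simp
  \<comment> \<open>This yields both laziness and nonnegativity of the diagonal entries.\<close>
  have half: "(\<Sum>B\<in>states - {A}. worm_off V E x A B) \<le> 1 / 2" if "A \<in> states" for A
  proof -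
    have "(\<Sum>B\<in>states - {A}. worm_off V E x A B)
        = (\<Sum>e\<in>E. if A \<triangle> {e} \<in> states - {A} then step A e else 0)"
      using sum_worm_off[of "states - {A}" A "\<lambda>_. 1"] finite_states by (simp cong: if_cong)
    also have "\<dots> \<le> (\<Sum>e\<in>E. step A e)" by (rule sum_mono) (auto simp: step_nonneg)
    finally show ?thesis using sum_step_le_half[OF that] by linarith
  qed
  then show "1 / 2 \<le> worm_P V E x A A" if "A \<in> states" for A
    using that by (fastforce simp: worm_P_def)
  then show "0 \<le> worm_P V E x A B" if "A \<in> states" "B \<in> states" for A B
    using that worm_off_nonneg by (cases "A = B") (force simp: worm_P_def)+
  show "(\<Sum>B\<in>states. worm_P V E x A B) = 1" if "A \<in> states" for A
  proof -
    have "(\<Sum>B\<in>states - {A}. worm_P V E x A B) = (\<Sum>B\<in>states - {A}. worm_off V E x A B)"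
      by (rule sum.cong[OF refl]) (auto simp: worm_P_def)
    then show ?thesis
      using that finite_states by (subst sum.remove[of _ A]) (simp_all add: worm_P_def[of _ _ _ A A])
  qed
  show "worm_pi V E x A * worm_P V E x A B = worm_pi V E x B * worm_P V E x B A"
    if "A \<in> states" "B \<in> states" for A B
    using weight_worm_off_sym[OF that] by (auto simp: worm_pi_def worm_P_def)
qed

text \<open>The condition \<open>g A = 0\<close> removes the diagonal entry; the intended
  \<open>g\<close> is the squared increment of \<open>f\<close> from \<open>A\<close>.\<close>

lemma sum_worm_P_eq_sum_step:
  assumes "A \<in> states" "g A = 0"
  shows "(\<Sum>B\<in>states. worm_P V E x A B * g B)
    = (\<Sum>e\<in>E. if A \<triangle> {e} \<in> states then step A e * g (A \<triangle> {e}) else 0)"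
proof -
  have "(\<Sum>B\<in>states. worm_P V E x A B * g B) = (\<Sum>B\<in>states. worm_off V E x A B * g B)"
    using assms by (intro sum.cong refl) (auto simp: worm_P_def)
  then show ?thesis using sum_worm_off[OF finite_states] by simp
qed

definition energy :: "('v set set \<Rightarrow> real) \<Rightarrow> real" where
  "energy f = (\<Sum>A\<in>states. \<Sum>e\<in>E. if A \<triangle> {e} \<in> states
     then weight A * step A e * (f A - f (A \<triangle> {e}))\<^sup>2 else 0)"

text \<open>The Dirichlet form of the chain equals \<open>energy f / (2 \<Sum>weight)\<close>, so the normalisation cancels.\<close>

lemma worm_poincareI:
  assumes "\<And>f. (\<Sum>A\<in>states. weight A * f A) = 0 \<Longrightarrow>
    (\<Sum>A\<in>states. weight A * (f A)\<^sup>2) \<le> \<rho> / 2 * energy f"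
  shows "lazy_reversible_chain.poincare states (worm_P V E x) (worm_pi V E x) \<rho>"
proof -
  interpret lazy_reversible_chain states "worm_P V E x" "worm_pi V E x" by (rule worm_chain)
  define W where "W = (\<Sum>T\<in>states. weight T)"
  have pi: "worm_pi V E x A = weight A / W" for A by (simp add: worm_pi_def W_def)
  have W: "0 < W" unfolding W_def by (rule total_weight_pos)
  show ?thesis unfolding poincare_def
  proof (intro allI impI)
    fix f assume "(\<Sum>A\<in>states. worm_pi V E x A * f A) = 0"
    moreover have "(\<Sum>A\<in>states. worm_pi V E x A * f A) = (\<Sum>A\<in>states. weight A * f A) / W"
      by (simp add: pi sum_divide_distrib)
    ultimately have 0: "(\<Sum>A\<in>states. weight A * f A) = 0" using W by simp
    have "(\<Sum>A\<in>states. \<Sum>B\<in>states. worm_pi V E x A * worm_P V E x A B * (f A - f B)\<^sup>2)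
        = (\<Sum>A\<in>states. weight A / W * (\<Sum>B\<in>states. worm_P V E x A B * (f A - f B)\<^sup>2))"
      by (simp add: pi sum_distrib_left mult.assoc)
    also have "\<dots> = (\<Sum>A\<in>states. weight A / W *
        (\<Sum>e\<in>E. if A \<triangle> {e} \<in> states then step A e * (f A - f (A \<triangle> {e}))\<^sup>2 else 0))"
      by (intro sum.cong refl) (simp add: sum_worm_P_eq_sum_step)
    also have "\<dots> = energy f / W"
      unfolding energy_def sum_divide_distrib sum_distrib_left by (intro sum.cong refl) auto
    finally have en: "(\<Sum>A\<in>states. \<Sum>B\<in>states. worm_pi V E x A * worm_P V E x A B * (f A - f B)\<^sup>2)
        = energy f / W" .
    have "(\<Sum>A\<in>states. worm_pi V E x A * (f A)\<^sup>2) = (\<Sum>A\<in>states. weight A * (f A)\<^sup>2) / W"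
      by (simp add: pi sum_divide_distrib)
    also have "\<dots> \<le> (\<rho> / 2 * energy f) / W"
      using assms[OF 0] W by (intro divide_right_mono) auto
    finally show "(\<Sum>A\<in>states. worm_pi V E x A * (f A)\<^sup>2)
      \<le> \<rho> / 2 * (\<Sum>A\<in>states. \<Sum>B\<in>states. worm_pi V E x A * worm_P V E x A B * (f A - f B)\<^sup>2)"
      unfolding en by simp
  qed
qed

section \<open>Canonical paths\<close>

abbreviation "Z0 \<equiv> bd_sum V E x {}"

definition xi :: "'v set set \<Rightarrow> real" where
  "xi X = (if X \<in> even_states then real (card V) else 2)"

lemma weight_eq: "weight A = xi A * prod x A"
  by (simp add: worm_weight_def xi_def)

lemma xi_nonneg: "0 \<le> xi X"
  by (simp add: xi_def)

lemma Z0_pos: "0 < Z0"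
  unfolding bd_sum_def
proof (rule sum_pos)
  show "finite {S. S \<subseteq> E \<and> bd S = {}}" using finite_E by simp
  have "{} \<in> {S. S \<subseteq> E \<and> bd S = {}}" by simp
  then show "{S. S \<subseteq> E \<and> bd S = {}} \<noteq> {}" by (metis empty_iff)
qed (use prod_x_pos in auto)

lemma sum_weight_even: "(\<Sum>A\<in>even_states. weight A) = card V * Z0"
proof -
  have "even_states = {S. S \<subseteq> E \<and> bd S = {}}" by (auto simp: even_states_iff)
  then show ?thesis unfolding bd_sum_def sum_distrib_left
    by (intro sum.cong) (auto simp: weight_eq xi_def even_states_iff)
qed

text \<open>Removing an edge at an odd vertex (or any edge, if there is none) keeps the boundary at size
  at most 2, so no decomposition into a path and cycles is needed to order the edges of \<open>X\<close>.\<close>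

lemma exists_unwinding:
  assumes "X \<in> states"
  shows "\<exists>es. distinct es \<and> set es = X \<and> (\<forall>i\<le>length es. set (drop i es) \<in> states)"
  using assms
proof (induction "card X" arbitrary: X)
  case 0
  then have "X = {}" using finite_sub by (auto simp: states_iff)
  then show ?case by (intro exI[of _ "[]"]) (use 0 in auto)
next
  case (Suc n)
  have XE: "X \<subseteq> E" using Suc.prems by (simp add: states_iff)
  have "\<exists>e\<in>X. X \<triangle> {e} \<in> states"
  proof (cases "bd X = {}")
    case True
    obtain e where e: "e \<in> X" using Suc.hyps(2) by fastforce
    then have "bd (X \<triangle> {e}) = e" using True XE by (subst bd_edge) auto
    then have "X \<triangle> {e} \<in> states"
      using e XE edge_card[of e] by (auto simp: states_iff intro!: sdiff_edge_subset)
    then show ?thesis using e by blast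
  next
    case False
    then have "card (bd X) = 2" using Suc.prems by (simp add: states_iff)
    then obtain u v where uv: "bd X = {u, v}" "u \<noteq> v" by (auto simp: card_2_iff)
    then have "u \<in> bd X" by simp
    then have "odd (card {e \<in> X. u \<in> e})" by (simp add: odd_verts_def)
    then have "{e \<in> X. u \<in> e} \<noteq> {}" by (metis card.empty even_zero)
    then obtain e where e: "e \<in> X" "u \<in> e" by blast
    then have "card e = 2" using XE edge_card by blast
    then obtain w where w: "e = {u, w}" "u \<noteq> w" using e(2) by (auto simp: card_2_iff)
    have "bd (X \<triangle> {e}) = {u, v} \<triangle> {u, w}" using bd_edge[of X e] XE e uv w by auto
    also have "\<dots> = (if v = w then {} else {v, w})" using uv w by (auto simp: sdiff_def)
    finally have "X \<triangle> {e} \<in> states"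
      using e XE by (auto simp: states_iff intro!: sdiff_edge_subset)
    then show ?thesis using e by blast
  qed
  then obtain e where e: "e \<in> X" "X \<triangle> {e} \<in> states" by blast
  have eq: "X \<triangle> {e} = X - {e}" using e by (auto simp: sdiff_def)
  have "card (X \<triangle> {e}) = n" using Suc.hyps(2) e finite_sub[OF XE] by (simp add: eq)
  then obtain es where es: "distinct es" "set es = X \<triangle> {e}"
      "\<And>i. i \<le> length es \<Longrightarrow> set (drop i es) \<in> states"
    using Suc.hyps(1) e(2) by metis
  have "set (drop i (e # es)) \<in> states" if "i \<le> length (e # es)" for i
    using that es e Suc.prems by (cases i) (auto simp: insert_absorb eq)
  moreover have "distinct (e # es)" "set (e # es) = X" using es e eq by auto
  ultimately show ?case by blast
qed

section \<open>The path generated by an unwinding\<close>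

definition unwind :: "'v set set \<Rightarrow> 'v set list" where
  "unwind X = (SOME es. distinct es \<and> set es = X \<and> (\<forall>i\<le>length es. set (drop i es) \<in> states))"

lemma unwind:
  assumes "X \<in> states"
  shows "distinct (unwind X)" "set (unwind X) = X"
    "i \<le> length (unwind X) \<Longrightarrow> set (drop i (unwind X)) \<in> states"
  using someI_ex[OF exists_unwinding[OF assms]] unfolding unwind_def by blast+

definition pre :: "'v set set \<Rightarrow> nat \<Rightarrow> 'v set set" where
  "pre X i = set (take i (unwind X))"

lemma pre_subset: "X \<in> states \<Longrightarrow> pre X i \<subseteq> X"
  using unwind(2)[of X] set_take_subset[of i "unwind X"] by (simp add: pre_def)

lemma pre_Suc:
  assumes "X \<in> states" "i < length (unwind X)"
  shows "pre X (Suc i) = pre X i \<triangle> {unwind X ! i}" "unwind X ! i \<notin> pre X i"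
proof -
  show notin: "unwind X ! i \<notin> pre X i"
    using assms unwind(1)[of X] by (auto simp: pre_def in_set_conv_nth nth_eq_iff_index_eq)
  then show "pre X (Suc i) = pre X i \<triangle> {unwind X ! i}"
    using assms by (auto simp: pre_def take_Suc_conv_app_nth sdiff_def)
qed

text \<open>As \<open>I\<close> and \<open>X\<close> have the same boundary,
  \<open>I \<triangle> pre X i\<close> has the boundary of the remaining suffix of the unwinding.
  This is why unwindings are constrained through their suffixes.\<close>

lemma sdiff_pre_states:
  assumes X: "X \<in> states" and I: "I \<subseteq> E" "bd I = bd X" and i: "i \<le> length (unwind X)"
  shows "I \<triangle> pre X i \<in> states"
proof -
  let ?s = "set (drop i (unwind X))"
  have XE: "X \<subseteq> E" using X by (simp add: states_iff)
  have "set (take i (unwind X)) \<inter> ?s = {}"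
    using unwind(1)[OF X] by (metis append_take_drop_id distinct_append)
  moreover have "pre X i \<union> ?s = X"
    using unwind(2)[OF X] by (metis append_take_drop_id pre_def set_append)
  ultimately have eq: "?s = pre X i \<triangle> X" by (auto simp: pre_def sdiff_def)
  have preE: "pre X i \<subseteq> E" using pre_subset[OF X] XE by blast
  have "bd (I \<triangle> pre X i) = bd ?s"
    unfolding eq using I XE preE by (simp add: bd_sdiff sdiff_commute)
  moreover have "?s \<in> states" by (rule unwind(3)[OF X i])
  ultimately show ?thesis using I preE by (auto simp: states_iff intro!: sdiff_subset)
qed

text \<open>Telescoping along the path followed by Cauchy-Schwarz; the flipped edges are distinct,
  so the length is at most \<open>card E\<close>.\<close>

lemma path_square_le:
  fixes f :: "'v set set \<Rightarrow> real"
  assumes X: "X \<in> states"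
  shows "(f I - f (I \<triangle> X))\<^sup>2 \<le> card E *
    (\<Sum>i<length (unwind X). (f (I \<triangle> pre X i) - f (I \<triangle> pre X i \<triangle> {unwind X ! i}))\<^sup>2)"
proof -
  let ?n = "length (unwind X)"
  let ?g = "\<lambda>i. f (I \<triangle> pre X i)"
  have n: "?n \<le> card E"
    using unwind(1,2)[OF X] X finite_E by (metis card_mono distinct_card states_iff)
  have "pre X 0 = {}" "pre X ?n = X" using unwind(2)[OF X] by (auto simp: pre_def)
  then have "f I - f (I \<triangle> X) = (\<Sum>i<?n. 1 * (?g i - ?g (Suc i)))"
    using sum_lessThan_telescope'[of ?g ?n] by simp
  also have "\<dots>\<^sup>2 \<le> (\<Sum>i<?n. 1) * (\<Sum>i<?n. 1 * (?g i - ?g (Suc i))\<^sup>2)"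
    by (rule square_weighted_sum_le) simp
  also have "\<dots> \<le> card E * (\<Sum>i<?n. (?g i - ?g (Suc i))\<^sup>2)"
    using n by (auto intro!: mult_right_mono sum_nonneg)
  also have "(\<Sum>i<?n. (?g i - ?g (Suc i))\<^sup>2)
      = (\<Sum>i<?n. (f (I \<triangle> pre X i) - f (I \<triangle> pre X i \<triangle> {unwind X ! i}))\<^sup>2)"
    by (intro sum.cong refl) (simp add: pre_Suc[OF X] sdiff_assoc)
  finally show ?thesis .
qed

section \<open>Congestion of the canonical paths\<close>

definition grad :: "('v set set \<Rightarrow> real) \<Rightarrow> 'v set \<Rightarrow> 'v set set \<Rightarrow> real" where
  "grad f e A = (f A - f (A \<triangle> {e}))\<^sup>2"

definition moves :: "'v set \<Rightarrow> 'v set set set" where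
  "moves e = {A \<in> states. A \<triangle> {e} \<in> states}"

lemma finite_moves: "finite (moves e)"
  using finite_states by (simp add: moves_def)

text \<open>For a fixed difference \<open>X\<close> and a fixed position in its unwinding, the start \<open>I\<close> and the current
  state \<open>A = I \<triangle> pre X i\<close> determine each other; \<open>insert e A \<triangle> X\<close> is the usual encoding.\<close>

lemma sum_paths_fixed_difference:
  assumes X: "X \<in> states"
  shows "(\<Sum>I | I \<subseteq> E \<and> bd I = bd X. prod x I * prod x (I \<triangle> X) * (f I - f (I \<triangle> X))\<^sup>2)
    \<le> card E * (\<Sum>e\<in>E. \<Sum>A\<in>moves e. prod x (insert e A) * prod x (insert e A \<triangle> X) * grad f e A)"
proof -
  let ?I = "{I. I \<subseteq> E \<and> bd I = bd X}"
  let ?n = "length (unwind X)"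
  let ?e = "\<lambda>i. unwind X ! i"
  let ?h = "\<lambda>e A. prod x (insert e A) * prod x (insert e A \<triangle> X) * grad f e A"
  have XE: "X \<subseteq> E" using X by (simp add: states_iff)
  have eX: "?e i \<in> X" if "i < ?n" for i
    using nth_mem[OF that] unwind(2)[OF X] by simp
  have xx: "prod x I * prod x (I \<triangle> X)
      = prod x (insert (?e i) (I \<triangle> pre X i)) * prod x (insert (?e i) (I \<triangle> pre X i) \<triangle> X)"
    if I: "I \<subseteq> E" and i: "i < ?n" for I i
  proof -
    \<comment> \<open>\<open>insert e A\<close> is either the current or the next state of the path,
      so it differs from \<open>I\<close> by a prefix of the unwinding, which lies inside
      \<open>X\<close>.\<close>
    have "\<exists>Y. Y \<subseteq> X \<and> insert (?e i) (I \<triangle> pre X i) = I \<triangle> Y"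
    proof (cases "?e i \<in> I \<triangle> pre X i")
      case True
      then show ?thesis using pre_subset[OF X, of i] by (intro exI[of _ "pre X i"]) auto
    next
      case False
      then have "insert (?e i) (I \<triangle> pre X i) = I \<triangle> pre X i \<triangle> {?e i}"
        by (intro set_eqI) auto
      also have "\<dots> = I \<triangle> pre X (Suc i)" using pre_Suc(1)[OF X i] by (simp add: sdiff_assoc)
      finally show ?thesis using pre_subset[OF X, of "Suc i"] by (intro exI[of _ "pre X (Suc i)"]) simp
    qed
    then obtain Y where Y: "Y \<subseteq> X" "insert (?e i) (I \<triangle> pre X i) = I \<triangle> Y" by blast
    show ?thesis
      unfolding Y(2) using finite_sub I XE Y(1) by (intro prod_sdiff_exchange) auto
  qed
  have h_nonneg: "0 \<le> ?h e A" if "e \<in> E" "A \<in> moves e" for e A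
  proof -
    have sub: "insert e A \<subseteq> E" using that by (simp add: moves_def states_iff)
    then have "0 < prod x (insert e A)" "0 < prod x (insert e A \<triangle> X)"
      using prod_x_pos[of "insert e A"] prod_x_pos[OF sdiff_subset[OF sub XE]] by simp_all
    then show ?thesis by (simp add: grad_def)
  qed
  have "(\<Sum>I\<in>?I. prod x I * prod x (I \<triangle> X) * (f I - f (I \<triangle> X))\<^sup>2)
      \<le> (\<Sum>I\<in>?I. card E * (\<Sum>i<?n. ?h (?e i) (I \<triangle> pre X i)))"
  proof (rule sum_mono)
    fix I assume "I \<in> ?I"
    then have I: "I \<subseteq> E" by simp
    have "prod x I * prod x (I \<triangle> X) * (f I - f (I \<triangle> X))\<^sup>2
      \<le> prod x I * prod x (I \<triangle> X) * (card E * (\<Sum>i<?n. grad f (?e i) (I \<triangle> pre X i)))"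
    proof (rule mult_left_mono)
      have "0 < prod x I" "0 < prod x (I \<triangle> X)"
        using prod_x_pos[OF I] prod_x_pos[OF sdiff_subset[OF I XE]] .
      then show "0 \<le> prod x I * prod x (I \<triangle> X)" by simp
    qed (use path_square_le[OF X, of f I] in \<open>simp add: grad_def\<close>)
    also have "\<dots> = card E * (\<Sum>i<?n. prod x I * prod x (I \<triangle> X) * grad f (?e i) (I \<triangle> pre X i))"
      by (simp add: sum_distrib_left mult_ac)
    also have "\<dots> = card E * (\<Sum>i<?n. ?h (?e i) (I \<triangle> pre X i))"
      using xx[OF I] by simp
    finally show "prod x I * prod x (I \<triangle> X) * (f I - f (I \<triangle> X))\<^sup>2
      \<le> card E * (\<Sum>i<?n. ?h (?e i) (I \<triangle> pre X i))" .
  qed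
  also have "\<dots> = card E * (\<Sum>i<?n. \<Sum>I\<in>?I. ?h (?e i) (I \<triangle> pre X i))"
    unfolding sum_distrib_left[symmetric] by (subst sum.swap) simp
  also have "\<dots> \<le> card E * (\<Sum>i<?n. \<Sum>A\<in>moves (?e i). ?h (?e i) A)"
  proof (intro mult_left_mono sum_mono)
    fix i assume "i \<in> {..<?n}"
    then have i: "i < ?n" by simp
    have inj: "inj_on (\<lambda>I. I \<triangle> pre X i) ?I"
      by (rule inj_onI) (metis sdiff_cancel(1))
    have "(\<Sum>I\<in>?I. ?h (?e i) (I \<triangle> pre X i)) = (\<Sum>A\<in>(\<lambda>I. I \<triangle> pre X i) ` ?I. ?h (?e i) A)"
      by (simp add: sum.reindex[OF inj])
    also have "\<dots> \<le> (\<Sum>A\<in>moves (?e i). ?h (?e i) A)"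
    proof (rule sum_mono2[OF finite_moves])
      show "(\<lambda>I. I \<triangle> pre X i) ` ?I \<subseteq> moves (?e i)"
      proof (rule image_subsetI)
        fix I assume "I \<in> ?I"
        then have I: "I \<subseteq> E" "bd I = bd X" by auto
        have "I \<triangle> pre X (Suc i) \<in> states" using i by (intro sdiff_pre_states[OF X I]) simp
        then have "I \<triangle> pre X i \<triangle> {?e i} \<in> states"
          by (simp only: pre_Suc(1)[OF X i] sdiff_assoc)
        moreover have "I \<triangle> pre X i \<in> states" using i by (intro sdiff_pre_states[OF X I]) simp
        ultimately show "I \<triangle> pre X i \<in> moves (?e i)" by (simp add: moves_def)
      qed
    qed (use h_nonneg eX[OF i] XE in auto)
    finally show "(\<Sum>I\<in>?I. ?h (?e i) (I \<triangle> pre X i)) \<le> (\<Sum>A\<in>moves (?e i). ?h (?e i) A)" .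
  qed simp
  also have "(\<Sum>i<?n. \<Sum>A\<in>moves (?e i). ?h (?e i) A) = (\<Sum>e\<in>X. \<Sum>A\<in>moves e. ?h e A)"
    using bij_betw_nth[OF unwind(1)[OF X] refl refl] unwind(2)[OF X]
    by (intro sum.reindex_bij_betw[where g = "\<lambda>e. \<Sum>A\<in>moves e. ?h e A"]) simp
  \<comment> \<open>Enlarging the range to all of \<open>E\<close> makes it independent of
    \<open>X\<close>, so that the sums over \<open>X\<close> and \<open>e\<close> can later be
    exchanged.\<close>
  also have "card E * (\<Sum>e\<in>X. \<Sum>A\<in>moves e. ?h e A) \<le> card E * (\<Sum>e\<in>E. \<Sum>A\<in>moves e. ?h e A)"
    using XE finite_E h_nonneg by (intro mult_left_mono sum_mono2 sum_nonneg) auto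
  finally show ?thesis .
qed

text \<open>Group the differences by their boundary \<open>T\<close>. For fixed \<open>T\<close> the
  encodings \<open>B \<triangle> X\<close> run through all edge sets with boundary
  \<open>bd B \<triangle> T\<close>, of total weight at most \<open>Z0\<close>. With
  \<open>k\<close> vertices, the empty \<open>T\<close> counts \<open>k\<close> times and each pair
  twice: \<open>k + k (k - 1) = k^2\<close>.\<close>

lemma sum_encodings_le:
  assumes B: "B \<subseteq> E"
  shows "(\<Sum>X\<in>states. xi X * prod x (B \<triangle> X)) \<le> (card V)\<^sup>2 * Z0"
proof -
  let ?F = "\<lambda>T. {X. X \<subseteq> E \<and> bd X = T}"
  have fin: "finite (?F T)" for T using finite_E by simp
  have single: "(\<Sum>X\<in>?F T. prod x (B \<triangle> X)) \<le> Z0" if T: "T \<subseteq> V" for T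
  proof -
    have "(\<Sum>X\<in>?F T. prod x (B \<triangle> X)) = bd_sum V E x (bd B \<triangle> T)"
      unfolding bd_sum_def
      by (rule sum.reindex_bij_witness[where i = "\<lambda>S. B \<triangle> S" and j = "\<lambda>X. B \<triangle> X"])
         (use B in \<open>auto simp: bd_sdiff intro!: sdiff_subset\<close>)
    also have "\<dots> \<le> Z0"
      using finite_V finite_E edge_subset x_pos x_le_1 T bd_subset
      by (intro bd_sum_le_bd_sum_empty sdiff_subset) (auto simp: less_imp_le)
    finally show ?thesis .
  qed
  let ?T2 = "{T. T \<subseteq> V \<and> card T = 2}"
  have fin2: "finite ?T2" using finite_V by simp
  have "states = ?F {} \<union> (\<Union>T\<in>?T2. ?F T)"
    using bd_subset by (auto simp: states_iff)
  moreover have "?F {} \<inter> (\<Union>T\<in>?T2. ?F T) = {}" by auto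
  ultimately have "(\<Sum>X\<in>states. xi X * prod x (B \<triangle> X))
     = (\<Sum>X\<in>?F {}. xi X * prod x (B \<triangle> X)) + (\<Sum>X\<in>(\<Union>T\<in>?T2. ?F T). xi X * prod x (B \<triangle> X))"
    using fin fin2 by (simp add: sum.union_disjoint)
  also have "(\<Sum>X\<in>?F {}. xi X * prod x (B \<triangle> X)) = card V * (\<Sum>X\<in>?F {}. prod x (B \<triangle> X))"
    unfolding sum_distrib_left by (intro sum.cong refl) (simp add: xi_def even_states_iff)
  also have "(\<Sum>X\<in>(\<Union>T\<in>?T2. ?F T). xi X * prod x (B \<triangle> X)) = (\<Sum>T\<in>?T2. \<Sum>X\<in>?F T. xi X * prod x (B \<triangle> X))"
    using fin fin2 by (intro sum.UNION_disjoint) auto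
  also have "\<dots> = (\<Sum>T\<in>?T2. 2 * (\<Sum>X\<in>?F T. prod x (B \<triangle> X)))"
    unfolding sum_distrib_left by (intro sum.cong refl) (auto simp: xi_def even_states_iff)
  also have "card V * (\<Sum>X\<in>?F {}. prod x (B \<triangle> X)) + \<dots> \<le> card V * Z0 + (\<Sum>T\<in>?T2. 2 * Z0)"
    by (intro add_mono mult_left_mono sum_mono single) auto
  also have "\<dots> = (card V + 2 * (card V choose 2)) * Z0"
    using n_subsets[OF finite_V, of 2] by (simp add: algebra_simps)
  also have "2 * (card V choose 2) = card V * (card V - 1)"
    by (cases "card V") (simp_all add: choose_two)
  also have "card V + card V * (card V - 1) = (card V)\<^sup>2"
    using card_V_ge_2 by (cases "card V") (auto simp: power2_eq_square)
  finally show ?thesis by simp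
qed

text \<open>Because \<open>F\<close> is even, \<open>X = I \<triangle> F\<close> has the boundary of
  \<open>I\<close>, so it is a worm state and can be unwound. The constant collects \<open>k\<close>
  from the weight of \<open>F\<close>, \<open>m\<close> from the path length, \<open>2m\<close> from
  the flow bound and \<open>k^2 * Z0\<close> from the encodings.\<close>

lemma sum_to_even_states_le_energy:
  "(\<Sum>I\<in>states. \<Sum>F\<in>even_states. weight I * weight F * (f I - f F)\<^sup>2)
    \<le> 2 * (card E)\<^sup>2 * card V ^ 3 * Z0 * energy f"
proof -
  let ?B = "\<lambda>X. {I. I \<subseteq> E \<and> bd I = bd X}"
  let ?t = "\<lambda>X I. prod x I * prod x (I \<triangle> X) * (f I - f (I \<triangle> X))\<^sup>2"
  let ?k = "real (card V)" let ?m = "real (card E)"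
  have finB: "finite (?B X)" for X using finite_E by simp
  \<comment> \<open>The prefactor \<open>xi\<close> sees only the boundary, so \<open>xi I\<close>
    may be replaced by \<open>xi (I \<triangle> F)\<close>; then it depends on the difference
    alone.\<close>
  have fwd: "I \<triangle> F \<in> states" "bd (I \<triangle> F) = bd I"
      "?k * (xi (I \<triangle> F) * (prod x I * prod x F)) = weight I * weight F"
    if IF: "I \<in> states" "F \<in> even_states" for I F
  proof -
    have IE: "I \<subseteq> E" "F \<subseteq> E" "bd F = {}" using IF by (auto simp: states_iff even_states_iff)
    then show bdX: "bd (I \<triangle> F) = bd I" by (simp add: bd_sdiff)
    then show "I \<triangle> F \<in> states" using IF IE by (auto simp: states_iff sdiff_subset)
    have "xi (I \<triangle> F) = xi I" using IE bdX by (auto simp: xi_def even_states_iff sdiff_subset)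
    then show "?k * (xi (I \<triangle> F) * (prod x I * prod x F)) = weight I * weight F"
      using IF by (simp add: weight_eq xi_def)
  qed
  have bwd: "I \<in> states" "I \<triangle> X \<in> even_states" if "X \<in> states" "I \<subseteq> E" "bd I = bd X" for X I
    using that by (auto simp: states_iff even_states_iff bd_sdiff sdiff_subset)
  have "(\<Sum>I\<in>states. \<Sum>F\<in>even_states. weight I * weight F * (f I - f F)\<^sup>2)
      = (\<Sum>(I, F)\<in>states \<times> even_states. weight I * weight F * (f I - f F)\<^sup>2)"
    by (simp add: sum.cartesian_product)
  also have "\<dots> = (\<Sum>(X, I)\<in>Sigma states ?B. ?k * xi X * ?t X I)"
    by (rule sum.reindex_bij_witness[where i = "\<lambda>(X, I). (I, I \<triangle> X)" and j = "\<lambda>(I, F). (I \<triangle> F, I)"])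
       (auto simp: fwd bwd dest: subsetD[OF states_subset])
  also have "\<dots> = (\<Sum>X\<in>states. \<Sum>I\<in>?B X. ?k * xi X * ?t X I)"
    using finite_states finB by (simp add: sum.Sigma)
  also have "\<dots> = (\<Sum>X\<in>states. ?k * xi X * (\<Sum>I\<in>?B X. ?t X I))"
    by (simp add: sum_distrib_left)
  also have "\<dots> \<le> (\<Sum>X\<in>states. ?k * xi X * (?m * (\<Sum>e\<in>E. \<Sum>A\<in>moves e.
      prod x (insert e A) * prod x (insert e A \<triangle> X) * grad f e A)))"
    by (intro sum_mono mult_left_mono sum_paths_fixed_difference mult_nonneg_nonneg xi_nonneg) auto
  also have "\<dots> = ?k * ?m * (\<Sum>X\<in>states. \<Sum>e\<in>E. \<Sum>A\<in>moves e.
      prod x (insert e A) * grad f e A * (xi X * prod x (insert e A \<triangle> X)))"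
    unfolding sum_distrib_left by (intro sum.cong refl) (simp add: mult_ac)
  also have "(\<Sum>X\<in>states. \<Sum>e\<in>E. \<Sum>A\<in>moves e.
      prod x (insert e A) * grad f e A * (xi X * prod x (insert e A \<triangle> X)))
    = (\<Sum>e\<in>E. \<Sum>X\<in>states. \<Sum>A\<in>moves e.
      prod x (insert e A) * grad f e A * (xi X * prod x (insert e A \<triangle> X)))"
    by (rule sum.swap)
  also have "\<dots> = (\<Sum>e\<in>E. \<Sum>A\<in>moves e. prod x (insert e A) * grad f e A *
      (\<Sum>X\<in>states. xi X * prod x (insert e A \<triangle> X)))"
    unfolding sum_distrib_left by (rule sum.cong[OF refl], rule sum.swap)
  also have "?k * ?m * \<dots> \<le> ?k * ?m * (\<Sum>e\<in>E. \<Sum>A\<in>moves e.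
      (2 * ?m * (weight A * step A e)) * grad f e A * (?k\<^sup>2 * Z0))"
  proof (intro mult_left_mono[of _ _ "?k * ?m"] sum_mono)
    fix e A assume e: "e \<in> E" and "A \<in> moves e"
    then have A: "A \<in> states" "A \<triangle> {e} \<in> states" by (auto simp: moves_def)
    then have sub: "insert e A \<subseteq> E" using e by (simp add: states_iff)
    have px: "prod x (insert e A) \<le> 2 * ?m * (weight A * step A e)"
      using weight_step_ge[OF A e] card_E_pos by (simp add: field_simps)
    have "0 < prod x (insert e A)" by (rule prod_x_pos[OF sub])
    then show "prod x (insert e A) * grad f e A * (\<Sum>X\<in>states. xi X * prod x (insert e A \<triangle> X))
      \<le> (2 * ?m * (weight A * step A e)) * grad f e A * (?k\<^sup>2 * Z0)"
      using px sum_encodings_le[OF sub] sub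
      by (intro mult_mono mult_nonneg_nonneg sum_nonneg xi_nonneg less_imp_le[OF prod_x_pos] sdiff_subset)
         (auto simp: grad_def states_iff less_imp_le[OF weight_pos] step_nonneg)
  qed simp
  also have "(\<Sum>e\<in>E. \<Sum>A\<in>moves e. (2 * ?m * (weight A * step A e)) * grad f e A * (?k\<^sup>2 * Z0))
      = 2 * ?m * ?k\<^sup>2 * Z0 * (\<Sum>e\<in>E. \<Sum>A\<in>moves e. weight A * step A e * grad f e A)"
    unfolding sum_distrib_left by (intro sum.cong refl) (simp add: mult_ac)
  also have "(\<Sum>e\<in>E. \<Sum>A\<in>moves e. weight A * step A e * grad f e A) = energy f"
  proof -
    have "(\<Sum>A\<in>moves e. weight A * step A e * grad f e A)
      = (\<Sum>A\<in>states. if A \<triangle> {e} \<in> states then weight A * step A e * (f A - f (A \<triangle> {e}))\<^sup>2 else 0)" for e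
      unfolding moves_def grad_def using finite_states by (simp add: sum.inter_filter)
    then show ?thesis unfolding energy_def by (simp add: sum.swap[of _ states E])
  qed
  finally show ?thesis by (simp add: power2_eq_square power3_eq_cube mult_ac)
qed

text \<open>Expand the square in the sum over pairs with even second member: the cross term vanishes
  by the mean-zero condition, and one of the two other nonnegative terms is the second moment times
  the total even weight \<open>k * Z0\<close>. Dividing by it cancels \<open>Z0\<close> and one
  factor \<open>k\<close>.\<close>

lemma worm_poincare:
  "lazy_reversible_chain.poincare states (worm_P V E x) (worm_pi V E x) (4 * (card E)\<^sup>2 * (card V)\<^sup>2)"
proof (rule worm_poincareI)
  fix f assume mean: "(\<Sum>A\<in>states. weight A * f A) = 0"
  let ?k = "real (card V)" let ?m = "real (card E)"
  let ?N = "\<Sum>A\<in>states. weight A * (f A)\<^sup>2"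
  let ?S = "\<Sum>F\<in>even_states. weight F"
  have "(\<Sum>I\<in>states. \<Sum>F\<in>even_states. weight I * weight F * (f I - f F)\<^sup>2)
     = (\<Sum>I\<in>states. \<Sum>F\<in>even_states. (weight I * (f I)\<^sup>2) * weight F)
       + (\<Sum>I\<in>states. \<Sum>F\<in>even_states. weight I * (weight F * (f F)\<^sup>2))
       - 2 * (\<Sum>I\<in>states. \<Sum>F\<in>even_states. (weight I * f I) * (weight F * f F))"
    unfolding sum_distrib_left[of 2] sum.distrib[symmetric] sum_subtractf[symmetric]
    by (intro sum.cong refl) (simp add: power2_eq_square algebra_simps)
  also have "\<dots> = ?N * ?S + (\<Sum>I\<in>states. weight I) * (\<Sum>F\<in>even_states. weight F * (f F)\<^sup>2)"
    unfolding sum_product[symmetric] mean by simp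
  also have "\<dots> \<ge> ?N * ?S"
    using weight_pos
    by (auto simp: states_iff even_states_iff less_imp_le intro!: mult_nonneg_nonneg sum_nonneg)
  finally have "?N * (?k * Z0) \<le> 2 * ?m\<^sup>2 * ?k ^ 3 * Z0 * energy f"
    using sum_to_even_states_le_energy[of f] unfolding sum_weight_even by simp
  also have "\<dots> = (2 * ?m\<^sup>2 * ?k\<^sup>2 * energy f) * (?k * Z0)"
    by (simp add: power2_eq_square power3_eq_cube)
  finally have "?N \<le> 2 * ?m\<^sup>2 * ?k\<^sup>2 * energy f"
    using Z0_pos card_V_ge_2 by (simp add: mult_le_cancel_right)
  then show "?N \<le> real (4 * (card E)\<^sup>2 * (card V)\<^sup>2) / 2 * energy f" by (simp add: mult_ac)
qed

text \<open>With a single edge the canonical path bound is too weak by a constant factor.\<close>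

lemma worm_poincare_single_edge:
  assumes E: "E = {e}" and V: "card V = 2"
  shows "lazy_reversible_chain.poincare states (worm_P V E x) (worm_pi V E x) 4"
proof (rule worm_poincareI)
  fix f assume mean: "(\<Sum>A\<in>states. weight A * f A) = 0"
  have eE: "e \<in> E" by (simp add: E)
  have bd_e: "bd {e} = e" using edge_subset[OF eE] by (rule odd_verts_singleton)
  have c2: "card e = 2" by (rule edge_card[OF eE])
  have e_ne: "e \<noteq> {}" using c2 by auto
  have st: "states = {{}, {e}}"
  proof (rule set_eqI)
    fix A
    have "A \<subseteq> E \<longleftrightarrow> A = {} \<or> A = {e}" by (simp add: E subset_singleton_iff)
    then show "A \<in> states \<longleftrightarrow> A \<in> {{}, {e}}"
      using c2 bd_e by (cases "A = {}"; cases "A = {e}") (simp_all add: states_iff)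
  qed
  have ev: "{} \<in> even_states" "{e} \<notin> even_states"
    using e_ne bd_e by (auto simp: even_states_iff)
  have w: "weight {} = 2" "weight {e} = 2 * x e" using ev V by (auto simp: weight_eq xi_def)
  have "deg w = 1" if "w \<in> e" for w
  proof -
    have "{e' \<in> E. w \<in> e'} = {e}" using that E by auto
    then show ?thesis by (simp add: gdeg_def)
  qed
  then have s: "(\<Sum>w\<in>e. 1 / deg w) = 2" using c2 by simp
  have sd: "{} \<triangle> {e} = {e}" "{e} \<triangle> {e} = {}" by simp_all
  have ws0: "weight {} * step {} e = x e"
    using weight_step_even[of "{}" e] ev st eE s by simp
  have ws1: "weight {e} * step {e} e = x e"
    using weight_step_even[of "{e}" e] ev st eE s by simp
  have en: "energy f = 2 * x e * (f {} - f {e})\<^sup>2"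
  proof -
    have "energy f = weight {} * step {} e * (f {} - f {e})\<^sup>2 + weight {e} * step {e} e * (f {e} - f {})\<^sup>2"
      unfolding energy_def st unfolding E by simp
    then show ?thesis unfolding ws0 ws1 by (simp add: power2_commute)
  qed
  \<comment> \<open>Mean-zero functions form a line here. With \<open>g = f {e}\<close> and
    \<open>x\<close> for \<open>x e\<close>, the claim reads
    \<open>2 x (1 + x) g^2 <= 4 x (1 + x)^2 g^2\<close>.\<close>
  have f0: "f {} = - x e * f {e}" using mean by (simp add: st w)
  have "x e * x e * (f {e})\<^sup>2 \<ge> 0" "x e * (f {e})\<^sup>2 \<ge> 0" "x e * x e * x e * (f {e})\<^sup>2 \<ge> 0"
    using x_pos[OF eE] by simp_all
  then show "(\<Sum>A\<in>states. weight A * (f A)\<^sup>2) \<le> 4 / 2 * energy f"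
    by (simp add: st w en f0 power2_eq_square algebra_simps)
qed

text \<open>Every weight is at least \<open>2 * xm ^ n\<close>, while at most \<open>2 ^ n\<close>
  states have weight at most \<open>card V <= 2 ^ (n + 1)\<close> each.\<close>

lemma inverse_worm_pi_le:
  assumes A: "A \<in> states" and xm: "0 < xm" "\<And>e. e \<in> E \<Longrightarrow> xm \<le> x e"
    and n: "card E \<le> n" "card V \<le> n + 1"
  shows "1 / worm_pi V E x A \<le> ((2 / xm) ^ n)\<^sup>2"
proof -
  have AE: "A \<subseteq> E" using A by (simp add: states_iff)
  obtain e where "e \<in> E" using edges_nonempty by blast
  then have xm1: "xm \<le> 1" using xm(2) x_le_1 by fastforce
  have "xm ^ n \<le> xm ^ card A"
    using xm(1) xm1 n card_mono[OF finite_E AE] by (intro power_decreasing) auto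
  also have "\<dots> = (\<Prod>e\<in>A. xm)" by simp
  also have "\<dots> \<le> prod x A" using xm AE by (intro prod_mono) (auto simp: less_imp_le)
  finally have "2 * xm ^ n \<le> xi A * prod x A"
    using card_V_ge_2 xm(1) by (intro mult_mono) (auto simp: xi_def)
  then have w: "2 * xm ^ n \<le> weight A" by (simp add: weight_eq)
  have "(\<Sum>T\<in>states. weight T) \<le> (\<Sum>T\<in>states. card V)"
    unfolding of_nat_sum
  proof (rule sum_mono)
    fix T assume "T \<in> states"
    then have "T \<subseteq> E" by (simp add: states_iff)
    then have "prod x T \<le> 1" "0 < prod x T" using prod_x_antimono[of "{}" T] prod_x_pos by auto
    then have "xi T * prod x T \<le> real (card V) * 1"
      using card_V_ge_2 by (intro mult_mono) (auto simp: xi_def)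
    then show "weight T \<le> card V" by (simp add: weight_eq)
  qed
  also have "\<dots> = card V * card states" by simp
  also have "\<dots> \<le> 2 ^ (n + 1) * 2 ^ n"
  proof -
    have "card states \<le> card (Pow E)" using states_subset finite_E by (intro card_mono) auto
    also have "\<dots> \<le> 2 ^ n" using n by (simp add: card_Pow finite_E)
    finally have "card states \<le> 2 ^ n" .
    moreover have "card V \<le> 2 ^ (n + 1)"
      using n(2) less_exp[of "n + 1"] by linarith
    ultimately have "card V * card states \<le> 2 ^ (n + 1) * 2 ^ n" by (intro mult_mono) auto
    then have "real (card V * card states) \<le> real (2 ^ (n + 1) * 2 ^ n)" by (rule of_nat_mono)
    then show ?thesis by simp
  qed
  finally have W: "(\<Sum>T\<in>states. weight T) \<le> 2 ^ (n + 1) * 2 ^ n" by simp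
  have "1 / worm_pi V E x A = (\<Sum>T\<in>states. weight T) / weight A" by (simp add: worm_pi_def)
  also have "\<dots> \<le> (2 ^ (n + 1) * 2 ^ n) / (2 * xm ^ n)"
    using W w xm(1) total_weight_pos by (intro frac_le) auto
  also have "\<dots> = (2 ^ n)\<^sup>2 / xm ^ n" by (simp add: power2_eq_square)
  \<comment> \<open>A spare factor \<open>xm ^ n <= 1\<close> is given away to obtain a perfect
    square, whose root matches the logarithm \<open>n * ln (2 / xm)\<close>.\<close>
  also have "\<dots> \<le> (2 ^ n)\<^sup>2 / (xm ^ n)\<^sup>2"
  proof (rule divide_left_mono)
    have "xm ^ n \<le> 1" using xm(1) xm1 by (intro power_le_one) auto
    then have "xm ^ n * xm ^ n \<le> xm ^ n * 1" using xm(1) by (intro mult_left_mono) auto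
    then show "(xm ^ n)\<^sup>2 \<le> xm ^ n" by (simp add: power2_eq_square)
  qed (use xm(1) in auto)
  also have "\<dots> = ((2 / xm) ^ n)\<^sup>2" by (simp add: power_divide)
  finally show ?thesis .
qed

text \<open>The \<open>- 1\<close> permits \<open>t\<close> to be the floor of the real bound, so
  the final estimate carries no rounding term.\<close>

lemma mixing_time_le:
  assumes P: "lazy_reversible_chain.poincare states (worm_P V E x) (worm_pi V E x) \<rho>" and \<rho>: "4 \<le> \<rho>"
    and xm: "0 < xm" "\<And>e. e \<in> E \<Longrightarrow> xm \<le> x e"
    and n: "card E \<le> n" "card V \<le> n + 1" and \<epsilon>: "0 < \<epsilon>"
    and t: "\<rho> * (ln (2 / \<epsilon>) + n * ln (2 / xm)) - 1 \<le> t"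
  shows "mixing_time states (worm_P V E x) (worm_pi V E x) \<epsilon> \<le> t"
  unfolding mixing_time_def
proof (intro Least_le ballI)
  fix A assume A: "A \<in> states"
  interpret lazy_reversible_chain states "worm_P V E x" "worm_pi V E x" by (rule worm_chain)
  let ?q = "(2 / xm) ^ n"
  have q: "0 < ?q" using xm(1) by simp
  have "tv_dist states (mat_pow states (worm_P V E x) t A) (worm_pi V E x)
      \<le> 1 / 2 * (1 - 1 / \<rho>) ^ t / sqrt (worm_pi V E x A)"
    using P \<rho> A by (intro tv_dist_mat_pow_le) auto
  also have "\<dots> = 1 / 2 * (1 - 1 / \<rho>) ^ t * sqrt (1 / worm_pi V E x A)"
    by (simp add: real_sqrt_divide)
  \<comment> \<open>As \<open>\<rho> >= 1\<close>, rounding down costs at most a factor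
    \<open>exp 1 <= 3\<close>. The 1/2 from total variation and the 2 in
    \<open>ln (2 / \<epsilon>)\<close> absorb it, leaving \<open>3/4 * \<epsilon>\<close>.\<close>
  also have "\<dots> \<le> 1 / 2 * (3 * (\<epsilon> / 2) / ?q) * ?q"
  proof (intro mult_mono)
    have "sqrt (1 / worm_pi V E x A) \<le> sqrt (?q\<^sup>2)"
      using inverse_worm_pi_le[OF A xm n] by (rule real_sqrt_le_mono)
    then show "sqrt (1 / worm_pi V E x A) \<le> ?q" using q by simp
    have "(1 - 1 / \<rho>) ^ t \<le> exp (- (1 / \<rho>)) ^ t"
      using \<rho> exp_ge_add_one_self[of "- (1 / \<rho>)"] by (intro power_mono) auto
    also have "\<dots> = exp (- (t / \<rho>))" by (simp add: exp_of_nat_mult[symmetric])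
    also have "\<dots> \<le> exp (1 - ln (2 / \<epsilon>) - n * ln (2 / xm))"
    proof -
      have "\<rho> * (ln (2 / \<epsilon>) + n * ln (2 / xm) - 1) \<le> t" using t \<rho> by (simp add: algebra_simps)
      then have "ln (2 / \<epsilon>) + n * ln (2 / xm) - 1 \<le> t / \<rho>"
        using \<rho> by (simp add: pos_le_divide_eq mult.commute)
      then show ?thesis by simp
    qed
    also have "\<dots> = exp 1 * (\<epsilon> / 2) / ?q"
      using \<epsilon> xm(1) by (simp add: exp_diff exp_of_nat_mult)
    also have "\<dots> \<le> 3 * (\<epsilon> / 2) / ?q"
      using exp_le \<epsilon> q by (intro divide_right_mono mult_right_mono) auto
    finally show "(1 - 1 / \<rho>) ^ t \<le> 3 * (\<epsilon> / 2) / ?q" .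
  qed (use q \<epsilon> \<rho> pi_pos[OF A] in auto)
  also have "\<dots> \<le> \<epsilon>" using q \<epsilon> by simp
  finally show "tv_dist states (mat_pow states (worm_P V E x) t A) (worm_pi V E x) \<le> \<epsilon>" .
qed

end

section \<open>The black-face graph\<close>

lemma orb_self: "d \<in> orb f d"
  unfolding orb_def by (auto intro: exI[of _ 0])

lemma orb_subset:
  assumes "f ` D \<subseteq> D" "d \<in> D"
  shows "orb f d \<subseteq> D"
proof -
  have "(f ^^ n) d \<in> D" for n by (induction n) (use assms in auto)
  then show ?thesis by (auto simp: orb_def)
qed

lemma orb_involution:
  assumes "f (f d) = d"
  shows "orb f d = {d, f d}"
proof -
  have "(f ^^ n) d = d \<or> (f ^^ n) d = f d" for n by (induction n) (use assms in auto)
  moreover have "d = (f ^^ 0) d" "f d = (f ^^ 1) d" by simp_all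
  ultimately show ?thesis unfolding orb_def by blast
qed

lemma
  assumes "plane_4regular_map D \<alpha> \<sigma>"
  shows finite_map_vertices: "finite (map_vertices D \<sigma>)"
    and card_map_vertices_pos: "0 < card (map_vertices D \<sigma>)"
    and finite_map_faces: "finite (map_faces D \<alpha> \<sigma>)"
  using assms unfolding plane_4regular_map_def map_vertices_def map_faces_def
  by (auto simp: card_gt_0_iff)

text \<open>Double counting of darts: the edges are disjoint pairs of darts, and the vertices cover
  all darts with four each.\<close>

lemma card_map_edges_le:
  assumes "plane_4regular_map D \<alpha> \<sigma>"
  shows "card (map_edges D \<alpha>) \<le> 2 * card (map_vertices D \<sigma>)"
proof -
  have fin: "finite D" and \<alpha>: "\<And>d. d \<in> D \<Longrightarrow> \<alpha> d \<in> D \<and> \<alpha> (\<alpha> d) = d \<and> \<alpha> d \<noteq> d"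
    and four: "\<And>d. d \<in> D \<Longrightarrow> card (orb \<sigma> d) = 4"
    using assms unfolding plane_4regular_map_def by auto
  have orb\<alpha>: "orb \<alpha> d = {d, \<alpha> d}" if "d \<in> D" for d using \<alpha>[OF that] by (simp add: orb_involution)
  have "2 * card (map_edges D \<alpha>) = card (\<Union> (map_edges D \<alpha>))"
  proof (rule card_partition)
    show "finite (map_edges D \<alpha>)" using fin by (simp add: map_edges_def)
    show "finite (\<Union> (map_edges D \<alpha>))" using fin by (auto simp: map_edges_def orb\<alpha>)
    show "card c = 2" if c: "c \<in> map_edges D \<alpha>" for c
    proof -
      obtain d where d: "d \<in> D" "c = {d, \<alpha> d}" using c by (auto simp: map_edges_def orb\<alpha>)
      then show ?thesis using \<alpha>[OF d(1)] by auto
    qed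
    show "c1 \<inter> c2 = {}" if c: "c1 \<in> map_edges D \<alpha>" "c2 \<in> map_edges D \<alpha>" "c1 \<noteq> c2" for c1 c2
    proof (rule ccontr)
      assume "c1 \<inter> c2 \<noteq> {}"
      then obtain z where z: "z \<in> c1" "z \<in> c2" by blast
      have "c' = {z, \<alpha> z}" if c': "c' \<in> map_edges D \<alpha>" "z \<in> c'" for c'
      proof -
        obtain d where d: "d \<in> D" "c' = {d, \<alpha> d}" using c'(1) by (auto simp: map_edges_def orb\<alpha>)
        then show ?thesis using c'(2) \<alpha>[OF d(1)] by auto
      qed
      then show False using c z by blast
    qed
  qed
  also have "\<dots> \<le> card D"
    using fin \<alpha> by (intro card_mono) (auto simp: map_edges_def orb\<alpha>)
  also have "\<dots> \<le> card (\<Union> (map_vertices D \<sigma>))"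
  proof (rule card_mono)
    show "finite (\<Union> (map_vertices D \<sigma>))"
      using fin four by (auto simp: map_vertices_def intro: card_ge_0_finite)
    show "D \<subseteq> \<Union> (map_vertices D \<sigma>)"
    proof
      fix d assume "d \<in> D"
      then show "d \<in> \<Union> (map_vertices D \<sigma>)"
        using orb_self[of d \<sigma>] by (auto simp: map_vertices_def)
    qed
  qed
  also have "\<dots> \<le> (\<Sum>v\<in>map_vertices D \<sigma>. card v)" by (rule card_Union_le_sum_card)
  also have "\<dots> = 4 * card (map_vertices D \<sigma>)"
  proof -
    have "card v = 4" if "v \<in> map_vertices D \<sigma>" for v
      using that four by (auto simp: map_vertices_def)
    then show ?thesis by simp
  qed
  finally show ?thesis by simp
qed

text \<open>Euler's formula with at most \<open>2n\<close> edges allows at most \<open>n + 2\<close>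
  faces, and the outer face is white.\<close>

lemma card_black_faces_le:
  assumes "plane_4regular_map D \<alpha> \<sigma>" "bw_coloring D \<alpha> \<sigma> od black"
  shows "card (black_faces D \<alpha> \<sigma> black) \<le> card (map_vertices D \<sigma>) + 1"
proof -
  have euler: "card (map_vertices D \<sigma>) + card (map_faces D \<alpha> \<sigma>) = card (map_edges D \<alpha>) + 2"
    using assms(1) unfolding plane_4regular_map_def by blast
  have "face_of \<alpha> \<sigma> od \<in> map_faces D \<alpha> \<sigma>" "\<not> black (face_of \<alpha> \<sigma> od)"
    using assms(2) by (auto simp: bw_coloring_def map_faces_def)
  then have "black_faces D \<alpha> \<sigma> black \<subset> map_faces D \<alpha> \<sigma>" by (auto simp: black_faces_def)
  then have "card (black_faces D \<alpha> \<sigma> black) < card (map_faces D \<alpha> \<sigma>)"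
    using finite_map_faces[OF assms(1)] by (rule psubset_card_mono[rotated])
  then show ?thesis using euler card_map_edges_le[OF assms(1)] by simp
qed

lemma black_edges_image: "black_edges D \<alpha> \<sigma> black \<subseteq> vertex_black \<alpha> \<sigma> black ` map_vertices D \<sigma>"
  by (auto simp: black_edges_def)

lemma card_black_edges_le:
  assumes "plane_4regular_map D \<alpha> \<sigma>"
  shows "card (black_edges D \<alpha> \<sigma> black) \<le> card (map_vertices D \<sigma>)"
  using surj_card_le[OF finite_map_vertices[OF assms] black_edges_image] .

lemma black_edge_subset:
  assumes "plane_4regular_map D \<alpha> \<sigma>" "e \<in> black_edges D \<alpha> \<sigma> black"
  shows "e \<subseteq> black_faces D \<alpha> \<sigma> black"
proof -
  have "bij_betw \<sigma> D D" using assms(1) unfolding plane_4regular_map_def by blast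
  then have \<sigma>: "\<sigma> ` D \<subseteq> D" by (simp add: bij_betw_def)
  obtain v where v: "v \<in> map_vertices D \<sigma>" "e = vertex_black \<alpha> \<sigma> black v"
    using assms(2) by (auto simp: black_edges_def)
  have "v \<subseteq> D" using v(1) orb_subset[OF \<sigma>] by (auto simp: map_vertices_def)
  then show ?thesis
    using \<sigma> unfolding v(2) vertex_black_def corner_face_def black_faces_def map_faces_def by blast
qed

text \<open>Ensures that the edge weights exceed 1 and thus that every \<open>x e\<close> is
  positive.\<close>

lemma black_mult_pos:
  assumes "plane_4regular_map D \<alpha> \<sigma>" "e \<in> black_edges D \<alpha> \<sigma> black"
  shows "0 < black_mult D \<alpha> \<sigma> black e"
  using assms(2) finite_map_vertices[OF assms(1)]
  by (auto simp: black_mult_def card_gt_0_iff black_edges_def)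

theorem theorem8:
  fixes D :: "'d set" and \<alpha> \<sigma> :: "'d \<Rightarrow> 'd" and od :: 'd
    and black :: "'d set \<Rightarrow> bool" and \<beta> \<epsilon> :: real
  assumes "plane_4regular_map D \<alpha> \<sigma>"
    and "bw_coloring D \<alpha> \<sigma> od black"
    and "\<beta> > 1"
    and "0 < \<epsilon>" and "\<epsilon> < 1"
    and "black_edges D \<alpha> \<sigma> black \<noteq> {}"
  shows
    "let n = card (map_vertices D \<sigma>);
         Bs = black_faces D \<alpha> \<sigma> black;
         Es = black_edges D \<alpha> \<sigma> black;
         \<beta>e = (\<lambda>e. \<beta> ^ black_mult D \<alpha> \<sigma> black e);
         x = (\<lambda>e. (\<beta>e e - 1) / (\<beta>e e + 1));
         \<beta>min = Min (\<beta>e ` Es)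
     in real (mixing_time (worm_states Bs Es) (worm_P Bs Es x) (worm_pi Bs Es x) \<epsilon>)
          \<le> 4 * real n ^ 7 * (ln (2 / \<epsilon>) / real n + ln (2 * (\<beta>min + 1) / (\<beta>min - 1)))"
proof -
  define n where "n = card (map_vertices D \<sigma>)"
  define Bs where "Bs = black_faces D \<alpha> \<sigma> black"
  define Es where "Es = black_edges D \<alpha> \<sigma> black"
  define \<beta>e where "\<beta>e = (\<lambda>e. \<beta> ^ black_mult D \<alpha> \<sigma> black e)"
  define x where "x = (\<lambda>e. (\<beta>e e - 1) / (\<beta>e e + 1))"
  define \<beta>min where "\<beta>min = Min (\<beta>e ` Es)"
  define xm where "xm = (\<beta>min - 1) / (\<beta>min + 1)"
  have finEs: "finite Es"
    unfolding Es_def using finite_map_vertices[OF assms(1)] black_edges_image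
    by (rule finite_surj)
  have \<beta>e: "1 < \<beta>e e" if "e \<in> Es" for e
    using that assms(3) black_mult_pos[OF assms(1)] by (simp add: \<beta>e_def Es_def one_less_power)
  have \<beta>min_le: "\<beta>min \<le> \<beta>e e" if "e \<in> Es" for e
    using that finEs by (simp add: \<beta>min_def)
  have \<beta>min: "1 < \<beta>min"
    using \<beta>e finEs assms(6) by (simp add: \<beta>min_def Es_def)
  have xm: "0 < xm" "xm < 1" using \<beta>min by (auto simp: xm_def)
  have xm_le: "xm \<le> x e" if "e \<in> Es" for e
  proof -
    \<comment> \<open>In this form \<open>(y - 1) / (y + 1)\<close> is visibly increasing in
      \<open>y\<close>.\<close>
    have "xm = 1 - 2 / (\<beta>min + 1)" "x e = 1 - 2 / (\<beta>e e + 1)"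
      using \<beta>min \<beta>e[OF that] by (auto simp: xm_def x_def field_simps)
    moreover have "2 / (\<beta>e e + 1) \<le> 2 / (\<beta>min + 1)"
      using \<beta>min \<beta>min_le[OF that] by (intro divide_left_mono) auto
    ultimately show ?thesis by simp
  qed
  interpret worm_graph Bs Es x
  proof
    show "finite Bs"
      using finite_map_faces[OF assms(1)] by (simp add: Bs_def black_faces_def)
    show "e \<subseteq> Bs" if "e \<in> Es" for e
      using that black_edge_subset[OF assms(1)] by (simp add: Es_def Bs_def)
    show "card e = 2" if "e \<in> Es" for e using that by (auto simp: Es_def black_edges_def)
    show "0 < x e" if "e \<in> Es" for e using xm_le[OF that] xm by simp
    show "x e \<le> 1" if "e \<in> Es" for e using \<beta>e[OF that] by (simp add: x_def)
    show "Es \<noteq> {}" using assms(6) by (simp add: Es_def)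
  qed
  have n: "card Es \<le> n" "card Bs \<le> n + 1"
    using card_black_edges_le[OF assms(1)] card_black_faces_le[OF assms(1,2)]
    by (auto simp: n_def Es_def Bs_def)
  have n1: "1 \<le> n" using card_map_vertices_pos[OF assms(1)] by (simp add: n_def)
  interpret lazy_reversible_chain states "worm_P Bs Es x" "worm_pi Bs Es x" by (rule worm_chain)
  have poin: "poincare (4 * real n ^ 6)"
  proof (cases "n = 1")
    case True
    then have "card Bs = 2" using n(2) card_V_ge_2 by simp
    moreover have "card Es = 1" using True n(1) card_E_pos by simp
    then obtain e where "Es = {e}" by (auto simp: card_1_singleton_iff)
    ultimately show ?thesis using worm_poincare_single_edge True by simp
  next
    case False
    \<comment> \<open>For \<open>n >= 2\<close> the vertex bound gives
      \<open>n + 1 <= 2 n <= n^2\<close>. This fails at \<open>n = 1\<close>, where the general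
      constant would be 16 instead of 4.\<close>
    then have "2 * n \<le> n * n" using n1 by simp
    then have "card Bs \<le> n\<^sup>2" using n(2) n1 unfolding power2_eq_square by linarith
    then have "4 * (card Es)\<^sup>2 * (card Bs)\<^sup>2 \<le> 4 * n\<^sup>2 * (n\<^sup>2)\<^sup>2"
      using n(1) by (intro mult_mono power_mono) auto
    also have "\<dots> = 4 * n ^ 6" by (simp flip: power_mult power_add)
    finally have "real (4 * (card Es)\<^sup>2 * (card Bs)\<^sup>2) \<le> 4 * real n ^ 6"
      by (metis of_nat_mono of_nat_mult of_nat_numeral of_nat_power)
    then show ?thesis by (rule poincare_mono[OF worm_poincare])
  qed
  define B where "B = 4 * real n ^ 6 * (ln (2 / \<epsilon>) + real n * ln (2 / xm))"
  have B0: "0 \<le> B"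
    unfolding B_def using assms(4,5) xm by (intro mult_nonneg_nonneg add_nonneg_nonneg) auto
  have "mixing_time states (worm_P Bs Es x) (worm_pi Bs Es x) \<epsilon> \<le> nat \<lfloor>B\<rfloor>"
  proof (rule mixing_time_le[OF poin _ xm(1) xm_le n assms(4)])
    show "4 \<le> 4 * real n ^ 6" using n1 by simp
    show "4 * real n ^ 6 * (ln (2 / \<epsilon>) + real n * ln (2 / xm)) - 1 \<le> real (nat \<lfloor>B\<rfloor>)"
      using B0 unfolding B_def[symmetric] by linarith
  qed
  then have "real (mixing_time states (worm_P Bs Es x) (worm_pi Bs Es x) \<epsilon>) \<le> B"
    using B0 by linarith
  \<comment> \<open>Pulling out one factor \<open>n\<close> raises the power from 6 to 7 and puts
    \<open>n\<close> under \<open>ln (2 / \<epsilon>)\<close>.\<close>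
  also have "B = 4 * real n ^ 7 * (ln (2 / \<epsilon>) / real n + ln (2 * (\<beta>min + 1) / (\<beta>min - 1)))"
  proof -
    have "2 / xm = 2 * (\<beta>min + 1) / (\<beta>min - 1)" by (simp add: xm_def)
    moreover have "real n ^ 7 = real n ^ 6 * real n" by (simp add: eval_nat_numeral)
    ultimately show ?thesis using n1 by (simp add: B_def field_simps)
  qed
  finally show ?thesis
    unfolding Let_def n_def Bs_def Es_def x_def \<beta>min_def \<beta>e_def .
qed

end
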